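(* Let $H$ be an infinite-dimensional separable complex Hilbert space, let $T\in\beta_0(H)$ and let $K\in\mathcal{B}(H)$ be compact. Let $c:=\inf\sigma_p(|T|)$, $D:=T^*T-c^2I$, $R:=T^*K+K^*T+K^*K$ and $L:=D+R$. Then $T+K\in\beta_0(H)$ if and only if $L$ has pure point spectrum and $\sigma_p(L)$ is reverse well-ordered.
   Context: $\mathcal{B}(H)$ is the algebra of bounded linear operators on $H$. A closed subspace $M\subseteq H$ is reducing for $T\in\mathcal{B}(H)$ if $TM\subseteq M$ and $TM^\perp\subseteq M^\perp$; $\mathcal{R}_T$ denotes the collection of all reducing subspaces of $T$. For $M\in\mathcal{R}_T$ non-zero, the restriction $T|_M$ is norm attaining if there is a unit vector $x\in M$ with $\|Tx\|=\|T|_M\|$, where $\|T|_M\|=\sup\{\|Ty\|:y\in M,\|y\|=1\}$. Put $|T|:=(T^*T)^{1/2}$ and $$\beta(H):=\{T\in\mathcal{B}(H): T|_M \text{ is norm attaining for every non-zero } M\in\mathcal{R}_T\},\qquad \beta_0(H):=\{T\in\mathcal{B}(H): |T|\in\beta(H)\}.$$ For $S\in\mathcal{B}(H)$, $\sigma_p(S)$ is the set of eigenvalues of $S$ (the $\lambda\in\mathbb{C}$ with $S-\lambda I$ not injective). $S$ has pure point spectrum if the closed linear span of its eigenvectors is all of $H$. A subset $\Lambda\subseteq\mathbb{R}$ is reverse well-ordered if every non-empty subset of $\Lambda$ has a greatest element. (For $T\in\beta_0(H)$ the operator $|T|$ has eigenvalues, so $c$ is a well-defined non-negative real number; $c$ need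 not be an eigenvalue.) *)

theory Defs
  imports "HOL-Analysis.Analysis"
begin

class scaleC =
  fixes scaleC :: "complex \<Rightarrow> 'a \<Rightarrow> 'a" (infixr "*\<^sub>C" 75)

class complex_vector = real_vector + scaleC +
  assumes scaleC_add_right: "a *\<^sub>C (x + y) = a *\<^sub>C x + a *\<^sub>C y"
    and scaleC_add_left: "(a + b) *\<^sub>C x = a *\<^sub>C x + b *\<^sub>C x"
    and scaleC_scaleC: "a *\<^sub>C b *\<^sub>C x = (a * b) *\<^sub>C x"
    and scaleC_one: "1 *\<^sub>C x = x"
    and scaleR_scaleC: "r *\<^sub>R x = complex_of_real r *\<^sub>C x"

global_interpretation complex_vector:
  vector_space "scaleC :: complex \<Rightarrow> 'a \<Rightarrow> 'a::complex_vector"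
  by standard (simp_all add: scaleC_add_right scaleC_add_left scaleC_scaleC scaleC_one)

text \<open>
  The inner product is linear in its first argument. The underlying real inner product of the
  library is the real part of \<open>cinner\<close>; hence the norm and the topology are the ones induced
  by \<open>cinner\<close>, and positive definiteness of \<open>cinner\<close> is inherited
  (\<open>cinner x x\<close> is real by conjugate symmetry).
\<close>

class complex_inner = real_inner + complex_vector +
  fixes cinner :: "'a \<Rightarrow> 'a \<Rightarrow> complex"
  assumes cinner_commute: "cinner x y = cnj (cinner y x)"
    and cinner_add_left: "cinner (x + y) z = cinner x z + cinner y z"
    and cinner_scaleC_left: "cinner (a *\<^sub>C x) y = a * cinner x y"
    and inner_eq_Re_cinner: "inner x y = Re (cinner x y)"

class complex_hilbert_space = complex_inner + complete_space

lemma cinner_self: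
  fixes x :: "'a::complex_inner"
  shows "cinner x x = complex_of_real ((norm x)\<^sup>2)"
proof -
  have "Im (cinner x x) = 0"
    using cinner_commute[of x x] by (metis Reals_cnj_iff complex_is_Real_iff)
  then show ?thesis
    by (simp add: complex_eq_iff power2_norm_eq_inner inner_eq_Re_cinner)
qed

definition bounded_clinear :: "('a::complex_inner \<Rightarrow> 'a) \<Rightarrow> bool" where
  "bounded_clinear T \<longleftrightarrow> bounded_linear T \<and> (\<forall>a x. T (a *\<^sub>C x) = a *\<^sub>C T x)"

definition compact_op :: "('a::complex_inner \<Rightarrow> 'a) \<Rightarrow> bool" where
  "compact_op K \<longleftrightarrow> bounded_clinear K \<and> compact (closure (K ` cball 0 1))"

text \<open>
  On a Hilbert space the adjoint of a bounded operator and the positive square root of a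
  positive operator exist and are unique, so the definite descriptions below are proper for
  such arguments.
\<close>

definition cadjoint :: "('a::complex_hilbert_space \<Rightarrow> 'a) \<Rightarrow> 'a \<Rightarrow> 'a" where
  "cadjoint T = (THE S. bounded_clinear S \<and> (\<forall>x y. cinner (T x) y = cinner x (S y)))"

definition positive_op :: "('a::complex_inner \<Rightarrow> 'a) \<Rightarrow> bool" where
  "positive_op S \<longleftrightarrow>
     bounded_clinear S \<and> (\<forall>x. cinner (S x) x \<in> \<real> \<and> 0 \<le> Re (cinner (S x) x))"

definition op_sqrt :: "('a::complex_hilbert_space \<Rightarrow> 'a) \<Rightarrow> 'a \<Rightarrow> 'a" where
  "op_sqrt A = (THE S. positive_op S \<and> S \<circ> S = A)"

definition op_abs :: "('a::complex_hilbert_space \<Rightarrow> 'a) \<Rightarrow> 'a \<Rightarrow> 'a" where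
  "op_abs T = op_sqrt (cadjoint T \<circ> T)"

definition orth_complement :: "'a::complex_inner set \<Rightarrow> 'a set" where
  "orth_complement M = {x. \<forall>y\<in>M. cinner x y = 0}"

definition reducing_subspaces :: "('a::complex_inner \<Rightarrow> 'a) \<Rightarrow> 'a set set" where
  "reducing_subspaces T =
     {M. closed M \<and> complex_vector.subspace M \<and>
         T ` M \<subseteq> M \<and> T ` orth_complement M \<subseteq> orth_complement M}"

definition norm_attaining_on :: "('a::complex_inner \<Rightarrow> 'a) \<Rightarrow> 'a set \<Rightarrow> bool" where
  "norm_attaining_on T M \<longleftrightarrow>
     (\<exists>x\<in>M. norm x = 1 \<and> norm (T x) = (SUP y\<in>{y\<in>M. norm y = 1}. norm (T y)))"

definition beta :: "('a::complex_inner \<Rightarrow> 'a) set" where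
  "beta = {T. bounded_clinear T \<and>
     (\<forall>M\<in>reducing_subspaces T. M \<noteq> {0} \<longrightarrow> norm_attaining_on T M)}"

definition beta0 :: "('a::complex_hilbert_space \<Rightarrow> 'a) set" where
  "beta0 = {T. bounded_clinear T \<and> op_abs T \<in> beta}"

definition point_spectrum :: "('a::complex_inner \<Rightarrow> 'a) \<Rightarrow> complex set" where
  "point_spectrum S = {\<mu>. \<not> inj (\<lambda>x. S x - \<mu> *\<^sub>C x)}"

definition eigenvectors :: "('a::complex_inner \<Rightarrow> 'a) \<Rightarrow> 'a set" where
  "eigenvectors S = {x. x \<noteq> 0 \<and> (\<exists>\<mu>. S x = \<mu> *\<^sub>C x)}"

definition pure_point_spectrum :: "('a::complex_inner \<Rightarrow> 'a) \<Rightarrow> bool" where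
  "pure_point_spectrum S \<longleftrightarrow> closure (complex_vector.span (eigenvectors S)) = UNIV"

text \<open>
  Point spectra are sets of complex numbers, so the condition that the set is real is part of
  the predicate, and the order is that of the real parts.
\<close>

definition reverse_well_ordered :: "complex set \<Rightarrow> bool" where
  "reverse_well_ordered \<Lambda> \<longleftrightarrow>
     \<Lambda> \<subseteq> \<real> \<and> (\<forall>A. A \<subseteq> \<Lambda> \<and> A \<noteq> {} \<longrightarrow> (\<exists>m\<in>A. \<forall>a\<in>A. Re a \<le> Re m))"

end

theory Submission
  imports Defs
begin

text \<open>
  Write \<open>S = T + K\<close>. Expanding the products gives \<open>L = S\<^sup>* S - c\<^sup>2 I = \<bar>S\<bar>\<^sup>2 - c\<^sup>2 I\<close>. The positive
  operator \<open>A = \<bar>S\<bar>\<close> has the same eigenvectors as \<open>L\<close>, and the eigenvalues correspond through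
  \<open>r \<mapsto> r\<^sup>2 - c\<^sup>2\<close>, which is strictly increasing on \<open>[0, \<infinity>)\<close>; so both spectral conditions on \<open>L\<close>
  are the same conditions on \<open>A\<close> (\<open>shifted_square_spectral_conditions\<close>). What remains is a
  characterisation of \<open>beta\<close> for a positive operator \<open>A\<close> (\<open>positive_op_in_beta_iff\<close>): membership
  means pure point spectrum with a reverse well-ordered set of eigenvalues.

  Its core is that \<open>A\<close> attains its norm on a non-zero invariant subspace \<open>M\<close> exactly when
  the norm of \<open>A\<close> restricted to \<open>M\<close> is an eigenvalue with an eigenvector in \<open>M\<close>
  (\<open>positive_op_norm_attaining_iff\<close>). If \<open>A\<close> is in \<open>beta\<close>, the orthogonal complement of all
  eigenvectors is reducing, and would contain an eigenvector if it were non-zero; hence the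
  eigenvectors span densely. Applied to the closed span of the eigenspaces for a set of
  eigenvalues, the same fact yields an eigenvalue that is the greatest element of that set.
  Conversely, if the eigenvectors of \<open>A\<close> span densely, those lying in a reducing subspace span it
  densely, because projecting an eigenvector to a reducing subspace gives zero or an
  eigenvector. The greatest eigenvalue that occurs in the subspace then bounds \<open>A\<close> there, by
  orthogonality of the eigenspaces.

  The modulus is a definite description, so this argument also rests on the existence of adjoints
  (from the Riesz representation theorem) and on the existence and uniqueness of
  positive square roots. The square root is obtained as the limit of an iteration by polynomials
  in the given operator, so it commutes with everything that operator commutes with, and this
  gives uniqueness.
\<close>

section \<open>Complex inner products\<close>

lemma cinner_add_right: "cinner x (y + z) = cinner x y + cinner x (z::'a::complex_inner)"
  by (metis cinner_add_left cinner_commute complex_cnj_add)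

lemma cinner_scaleC_right: "cinner x (a *\<^sub>C y) = cnj a * cinner x (y::'a::complex_inner)"
  by (metis cinner_commute cinner_scaleC_left complex_cnj_mult)

lemma cinner_zero_left [simp]: "cinner 0 (x::'a::complex_inner) = 0"
  using cinner_add_left[of 0 0 x] by simp

lemma cinner_zero_right [simp]: "cinner (x::'a::complex_inner) 0 = 0"
  using cinner_add_right[of x 0 0] by simp

lemma cinner_diff_left: "cinner (x - y) z = cinner x z - cinner y (z::'a::complex_inner)"
  using cinner_add_left[of "x - y" y z] by simp

lemma cinner_diff_right: "cinner x (y - z) = cinner x y - cinner x (z::'a::complex_inner)"
  using cinner_add_right[of x "y - z" z] by simp

lemma cinner_self_eq_0_iff [simp]: "cinner x x = 0 \<longleftrightarrow> x = (0::'a::complex_inner)"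
  by (simp add: cinner_self)

lemma cinner_eqI: "(\<And>x. cinner x y = cinner x z) \<Longrightarrow> y = (z::'a::complex_inner)"
  by (metis cinner_diff_right cinner_self_eq_0_iff eq_iff_diff_eq_0)

lemma norm_scaleC: "norm (a *\<^sub>C x) = norm a * norm (x::'a::complex_inner)"
proof -
  have "complex_of_real ((norm (a *\<^sub>C x))\<^sup>2) = a * cnj a * complex_of_real ((norm x)\<^sup>2)"
    by (simp only: cinner_self[symmetric] cinner_scaleC_left cinner_scaleC_right) simp
  also have "\<dots> = complex_of_real ((norm a * norm x)\<^sup>2)"
    by (simp add: complex_norm_square[symmetric] power_mult_distrib)
  finally have "(norm (a *\<^sub>C x))\<^sup>2 = (norm a * norm x)\<^sup>2"
    using of_real_eq_iff by blast
  then show ?thesis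
    by (simp add: power2_eq_iff_nonneg)
qed

lemma bounded_linear_scaleC: "bounded_linear (\<lambda>x::'a::complex_inner. a *\<^sub>C x)"
  by (rule bounded_linear_intro[where K = "norm a"])
    (auto simp: complex_vector.scale_right_distrib scaleR_scaleC norm_scaleC
      complex_vector.scale_left_commute mult.commute)

lemma Im_cinner_left: "Im (cinner x y) = inner ((- \<i>) *\<^sub>C x) (y::'a::complex_inner)"
  by (simp add: inner_eq_Re_cinner cinner_scaleC_left del: complex_vector.scale_minus_left)

lemma Im_cinner_right: "Im (cinner x y) = inner x (\<i> *\<^sub>C (y::'a::complex_inner))"
  by (simp add: inner_eq_Re_cinner cinner_scaleC_right)

lemma subspace_complex_imp_real:
  "complex_vector.subspace M \<Longrightarrow> subspace (M::'a::complex_inner set)"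
  by (simp add: complex_vector.subspace_def subspace_def scaleR_scaleC)

lemma closed_orth_complement: "closed (orth_complement (M::'a::complex_inner set))"
proof -
  have eq: "orth_complement M =
      (\<Inter>y\<in>M. {x. inner x y = 0} \<inter> {x. inner x (\<i> *\<^sub>C y) = 0})"
    by (auto simp: orth_complement_def complex_eq_iff inner_eq_Re_cinner
        Im_cinner_right[unfolded inner_eq_Re_cinner])
  have cl: "closed {x. inner x y = 0}" for y :: 'a
    by (intro closed_Collect_eq continuous_intros)
  show ?thesis
    unfolding eq by (intro closed_INT ballI closed_Int cl)
qed

lemma subspace_orth_complement: "complex_vector.subspace (orth_complement (M::'a::complex_inner set))"
  by (simp add: complex_vector.subspace_def orth_complement_def cinner_add_left cinner_scaleC_left)

lemma orth_complement_self: "x \<in> M \<Longrightarrow> x \<in> orth_complement M \<Longrightarrow> x = (0::'a::complex_inner)"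
  by (auto simp: orth_complement_def)

lemma orth_complement_antimono: "M \<subseteq> N \<Longrightarrow> orth_complement N \<subseteq> orth_complement M"
  by (auto simp: orth_complement_def)

lemma orth_complement_double: "M \<subseteq> orth_complement (orth_complement (M::'a::complex_inner set))"
  unfolding orth_complement_def by (auto, metis cinner_commute complex_cnj_zero)

text \<open>
  A double orthogonal complement is a closed subspace containing \<open>M\<close>, hence contains the closed span
  of \<open>M\<close>; taking complements once more gives the inclusion that is not mere monotonicity.
\<close>

lemma orth_complement_span_closure:
  "orth_complement (closure (complex_vector.span M)) = orth_complement (M::'a::complex_inner set)"
proof -
  have "complex_vector.span M \<subseteq> orth_complement (orth_complement M)"
    by (intro complex_vector.span_minimal orth_complement_double subspace_orth_complement)
  then have "closure (complex_vector.span M) \<subseteq> orth_complement (orth_complement M)"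
    by (intro closure_minimal closed_orth_complement)
  then have "orth_complement M \<subseteq> orth_complement (closure (complex_vector.span M))"
    by (meson orth_complement_antimono orth_complement_double order_trans)
  moreover have "M \<subseteq> closure (complex_vector.span M)"
    by (meson closure_subset complex_vector.span_superset order_trans)
  ultimately show ?thesis
    by (meson orth_complement_antimono subset_antisym)
qed

section \<open>Bounded operators\<close>

lemma bounded_clinear_add: "bounded_clinear T \<Longrightarrow> T (x + y) = T x + T y"
  by (simp add: bounded_clinear_def linear_simps)

lemma bounded_clinear_diff: "bounded_clinear T \<Longrightarrow> T (x - y) = T x - T y"
  by (simp add: bounded_clinear_def linear_simps)

lemma bounded_clinear_zero: "bounded_clinear T \<Longrightarrow> T 0 = 0"
  by (simp add: bounded_clinear_def linear_simps)

lemma bounded_clinear_scaleC: "bounded_clinear T \<Longrightarrow> T (a *\<^sub>C x) = a *\<^sub>C T x"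
  by (simp add: bounded_clinear_def)

lemma bounded_clinear_scaleR: "bounded_clinear T \<Longrightarrow> T (r *\<^sub>R x) = r *\<^sub>R T x"
  by (simp add: bounded_clinear_def linear_simps)

lemmas bounded_clinear_simps =
  bounded_clinear_add bounded_clinear_diff bounded_clinear_zero bounded_clinear_scaleC
  bounded_clinear_scaleR

lemma bounded_clinearI:
  assumes "\<And>x y. T (x + y) = T x + T y" "\<And>a x. T (a *\<^sub>C x) = a *\<^sub>C T x"
    and "\<And>x. norm (T x) \<le> norm x * B"
  shows "bounded_clinear T"
  unfolding bounded_clinear_def
  using assms by (auto intro!: bounded_linear_intro[where K = B] simp: scaleR_scaleC)

lemma bounded_clinear_bound:
  assumes "bounded_clinear T"
  obtains B where "0 < B" "\<And>x. norm (T x) \<le> B * norm x"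
  using assms bounded_linear.pos_bounded[of T] unfolding bounded_clinear_def
  by (metis mult.commute)

lemma bounded_clinear_add_op:
  "bounded_clinear S \<Longrightarrow> bounded_clinear T \<Longrightarrow> bounded_clinear (\<lambda>x. S x + T x)"
  by (simp add: bounded_clinear_def bounded_linear_add complex_vector.scale_right_distrib)

lemma bounded_clinear_diff_op:
  "bounded_clinear S \<Longrightarrow> bounded_clinear T \<Longrightarrow> bounded_clinear (\<lambda>x. S x - T x)"
  by (simp add: bounded_clinear_def bounded_linear_sub complex_vector.scale_right_diff_distrib)

lemma bounded_clinear_ident: "bounded_clinear (\<lambda>x. x)"
  by (simp add: bounded_clinear_def bounded_linear_ident)

lemma bounded_clinear_comp:
  "bounded_clinear S \<Longrightarrow> bounded_clinear T \<Longrightarrow> bounded_clinear (\<lambda>x. S (T x))"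
  by (simp add: bounded_clinear_def bounded_linear_compose)

lemma bounded_clinear_scaleR_op:
  "bounded_clinear T \<Longrightarrow> bounded_clinear (\<lambda>x. r *\<^sub>R T x)"
  unfolding bounded_clinear_def
  by (metis bounded_linear_const_scaleR complex_vector.scale_left_commute scaleR_scaleC)

section \<open>Orthogonal decomposition, Riesz representation and adjoints\<close>

text \<open>
  The nearest point of \<open>M\<close> to \<open>x\<close> is the common point of the nested sets of almost nearest points,
  whose diameters tend to zero by the parallelogram law. The difference between \<open>x\<close> and its nearest
  point is orthogonal to \<open>M\<close>, because moving along any direction of \<open>M\<close> cannot decrease the distance.
\<close>

lemma closed_subspace_decomposition:
  fixes M :: "'a::{real_inner,complete_space} set"
  assumes "closed M" "subspace M"
  obtains p q where "x = p + q" "p \<in> M" "\<And>y. y \<in> M \<Longrightarrow> inner q y = 0"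
proof -
  define d where "d = infdist x M"
  have M0: "M \<noteq> {}"
    using assms(2) subspace_0 by blast
  have d0: "0 \<le> d"
    by (simp add: d_def infdist_nonneg)
  have d_le: "d\<^sup>2 \<le> (norm (x - m))\<^sup>2" if "m \<in> M" for m
    using infdist_le[OF that, of x] d0 by (simp add: d_def dist_norm power_mono)
  define S where "S n = {m \<in> M. (norm (x - m))\<^sup>2 \<le> d\<^sup>2 + 1 / real (Suc n)}" for n
  have "closed (S n)" for n
  proof -
    have "closed {m. (norm (x - m))\<^sup>2 \<le> d\<^sup>2 + 1 / real (Suc n)}"
      by (intro closed_Collect_le continuous_intros)
    then show ?thesis
      using assms(1) unfolding S_def by (metis closed_Collect_conj Collect_mem_eq)
  qed
  moreover have "S n \<noteq> {}" for n
  proof -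
    have "d < sqrt (d\<^sup>2 + 1 / real (Suc n))"
      by (intro real_less_rsqrt) auto
    then obtain m where "m \<in> M" "dist x m < sqrt (d\<^sup>2 + 1 / real (Suc n))"
      unfolding d_def using M0 by (metis cINF_less_iff infdist_notempty bdd_below_image_dist)
    then have "m \<in> S n"
      unfolding S_def dist_norm
      by (smt (verit) d0 mem_Collect_eq norm_ge_zero real_le_rsqrt real_sqrt_le_iff real_sqrt_unique)
    then show ?thesis by blast
  qed
  moreover have "S n \<subseteq> S m" if "m \<le> n" for m n
    using that unfolding S_def by (auto intro: order_trans simp: frac_le)
  moreover have "\<exists>n. \<forall>y\<in>S n. \<forall>z\<in>S n. dist y z < e" if "e > 0" for e
  proof -
    obtain n where n: "4 / e\<^sup>2 < real (Suc n)"
      by (meson lessI less_trans of_nat_less_iff reals_Archimedean2)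
    have "dist y z < e" if "y \<in> S n" "z \<in> S n" for y z
    proof -
      have "(1/2) *\<^sub>R (y + z) \<in> M"
        using that assms(2) by (simp add: S_def subspace_add subspace_scale)
      then have "d\<^sup>2 \<le> (norm (x - (1/2) *\<^sub>R (y + z)))\<^sup>2"
        by (rule d_le)
      moreover have "(norm (y - z))\<^sup>2 + 4 * (norm (x - (1/2) *\<^sub>R (y + z)))\<^sup>2
          = 2 * (norm (x - y))\<^sup>2 + 2 * (norm (x - z))\<^sup>2"
        unfolding power2_norm_eq_inner
        by (simp add: inner_diff_left inner_diff_right inner_add_left inner_add_right inner_commute
            algebra_simps)
      ultimately have "(norm (y - z))\<^sup>2 \<le> 4 / real (Suc n)"
        using that by (simp add: S_def)
      also have "\<dots> < e\<^sup>2"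
        using n \<open>e > 0\<close> by (simp add: field_simps)
      finally show ?thesis
        using \<open>e > 0\<close> by (simp add: dist_norm power2_less_imp_less)
    qed
    then show ?thesis by blast
  qed
  ultimately obtain p where "\<Inter> (range S) = {p}"
    using decreasing_closed_nest_sing[of S] by metis
  then have pS: "p \<in> S n" for n
    by blast
  then have p: "p \<in> M"
    by (simp add: S_def)
  have "(norm (x - p))\<^sup>2 \<le> d\<^sup>2"
  proof (rule field_le_epsilon)
    fix e :: real assume "0 < e"
    then obtain n where "1 / real (Suc n) < e"
      using nat_approx_posE by blast
    then show "(norm (x - p))\<^sup>2 \<le> d\<^sup>2 + e"
      using pS[of n] by (simp add: S_def)
  qed
  have "inner (x - p) y = 0" if "y \<in> M" for y
  proof (cases "y = 0")
    case False
    \<comment> \<open>the minimiser of the quadratic polynomial \<open>t \<mapsto> (norm (x - p - t *\<^sub>R y))\<^sup>2\<close>\<close>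
    define t where "t = inner (x - p) y / inner y y"
    have "p + t *\<^sub>R y \<in> M"
      using p that assms(2) by (simp add: subspace_add subspace_scale)
    then have "(norm (x - p))\<^sup>2 \<le> (norm (x - (p + t *\<^sub>R y)))\<^sup>2"
      using d_le \<open>(norm (x - p))\<^sup>2 \<le> d\<^sup>2\<close> order_trans by blast
    also have "x - (p + t *\<^sub>R y) = (x - p) - t *\<^sub>R y"
      by simp
    also have "(norm (q - t *\<^sub>R y))\<^sup>2
        = (norm q)\<^sup>2 - 2 * t * inner q y + t * (t * inner y y)" for q
      unfolding power2_norm_eq_inner
      by (simp add: inner_diff_left inner_diff_right inner_commute algebra_simps)
    also have "t * inner y y = inner (x - p) y"
      using False by (simp add: t_def)
    finally have "t * inner (x - p) y \<le> 0"
      by simp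
    then have "(inner (x - p) y)\<^sup>2 / inner y y \<le> 0"
      by (simp add: t_def power2_eq_square)
    moreover have "0 < inner y y"
      using False by simp
    ultimately show ?thesis
      by (simp add: divide_le_0_iff del: inner_gt_zero_iff)
  qed simp
  with p that[of p "x - p"] show thesis by simp
qed

text \<open>
  A complex subspace is stable under \<open>\<i>\<close>, so orthogonality for the real inner product already forces
  both the real and the imaginary part of \<open>cinner\<close> to vanish.
\<close>

lemma orthogonal_decomposition:
  fixes M :: "'a::complex_hilbert_space set"
  assumes "closed M" "complex_vector.subspace M"
  obtains p q where "x = p + q" "p \<in> M" "q \<in> orth_complement M"
proof -
  obtain p q where pq: "x = p + q" "p \<in> M" "\<And>y. y \<in> M \<Longrightarrow> inner q y = 0"
    using closed_subspace_decomposition[OF assms(1) subspace_complex_imp_real[OF assms(2)]] by metis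
  have "cinner q y = 0" if "y \<in> M" for y
  proof -
    have "\<i> *\<^sub>C y \<in> M"
      using that assms(2) by (simp add: complex_vector.subspace_scale)
    then show ?thesis
      using pq(3) that by (simp add: complex_eq_iff Im_cinner_right inner_eq_Re_cinner[symmetric])
  qed
  then show thesis
    using that pq by (simp add: orth_complement_def)
qed

lemma complex_subspace_closure:
  fixes M :: "'a::complex_inner set"
  assumes M: "complex_vector.subspace M"
  shows "complex_vector.subspace (closure M)"
  unfolding complex_vector.subspace_def
proof (intro conjI ballI allI)
  show "0 \<in> closure M"
    using closure_subset complex_vector.subspace_0[OF M] by blast
next
  fix x y assume "x \<in> closure M" "y \<in> closure M"
  then obtain X Y where "\<And>n::nat. X n \<in> M" "X \<longlonglongrightarrow> x" "\<And>n::nat. Y n \<in> M" "Y \<longlonglongrightarrow> y"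
    by (metis closure_sequential)
  then show "x + y \<in> closure M"
    unfolding closure_sequential
    by (intro exI[of _ "\<lambda>n. X n + Y n"]) (auto intro: tendsto_add complex_vector.subspace_add[OF M])
next
  fix a x assume "x \<in> closure M"
  then obtain X where X: "\<And>n::nat. X n \<in> M" "X \<longlonglongrightarrow> x"
    by (metis closure_sequential)
  have "(\<lambda>n. a *\<^sub>C X n) \<longlonglongrightarrow> a *\<^sub>C x"
    using bounded_linear_scaleC X(2) by (rule bounded_linear.tendsto)
  then show "a *\<^sub>C x \<in> closure M"
    unfolding closure_sequential
    by (intro exI[of _ "\<lambda>n. a *\<^sub>C X n"]) (auto intro: X complex_vector.subspace_scale[OF M])
qed

lemma closure_span_eq_UNIV_iff:
  fixes E :: "'a::complex_hilbert_space set"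
  shows "closure (complex_vector.span E) = UNIV \<longleftrightarrow> orth_complement E = {0}"
proof
  assume "closure (complex_vector.span E) = UNIV"
  then have "orth_complement E = orth_complement UNIV"
    by (metis orth_complement_span_closure)
  also have "\<dots> = {0}"
    using orth_complement_self[of _ UNIV] by (auto simp: orth_complement_def)
  finally show "orth_complement E = {0}" .
next
  assume 0: "orth_complement E = {0}"
  have "complex_vector.subspace (closure (complex_vector.span E))"
    by (intro complex_subspace_closure complex_vector.subspace_span)
  then have "x \<in> closure (complex_vector.span E)" for x
    using orthogonal_decomposition[of "closure (complex_vector.span E)" x]
    by (metis 0 closed_closure orth_complement_span_closure singletonD add_0_right)
  then show "closure (complex_vector.span E) = UNIV"
    by blast
qed

text \<open>
  The kernel of a non-zero functional has a one-dimensional orthogonal complement; the representing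
  vector is the multiple \<open>z\<close> of a vector there for which \<open>f z = inner z z\<close>.
\<close>

lemma riesz_representation:
  fixes f :: "'a::{real_inner,complete_space} \<Rightarrow> real"
  assumes "bounded_linear f"
  shows "\<exists>z. \<forall>x. f x = inner x z"
proof (cases "\<forall>x. f x = 0")
  case True
  then show ?thesis by (intro exI[of _ 0]) simp
next
  case False
  interpret bounded_linear f by fact
  define M where "M = {x. f x = 0}"
  have "closed M"
    unfolding M_def by (intro closed_Collect_eq continuous_intros continuous_on)
  moreover have "subspace M"
    by (simp add: M_def subspace_def add scaleR zero)
  moreover obtain x0 where "f x0 \<noteq> 0"
    using False by blast
  ultimately obtain p q where pq: "x0 = p + q" "p \<in> M" "\<And>y. y \<in> M \<Longrightarrow> inner q y = 0"
    using closed_subspace_decomposition by metis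
  then have fq: "f q \<noteq> 0"
    using \<open>f x0 \<noteq> 0\<close> by (simp add: M_def add)
  then have q: "q \<noteq> 0"
    using zero by auto
  have "f x = inner x ((f q / inner q q) *\<^sub>R q)" for x
  proof -
    have "x - (f x / f q) *\<^sub>R q \<in> M"
      using fq by (simp add: M_def diff scaleR)
    then have "inner q x = (f x / f q) * inner q q"
      using pq(3) by (fastforce simp: inner_diff_right)
    then show ?thesis
      using fq q by (simp add: inner_commute[of x])
  qed
  then show ?thesis by blast
qed

text \<open>
  The adjoint is produced for the real inner product, where Riesz representation applies;
  since \<open>T\<close> commutes with multiplication by \<open>- \<i>\<close>, the imaginary parts agree as well.
\<close>

lemma cadjoint_exists:
  fixes T :: "'a::complex_hilbert_space \<Rightarrow> 'a"
  assumes T: "bounded_clinear T"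
  shows "\<exists>S. bounded_clinear S \<and> (\<forall>x y. cinner (T x) y = cinner x (S y))"
proof -
  have "bounded_linear (\<lambda>x. inner (T x) y)" for y
    using T unfolding bounded_clinear_def
    by (intro bounded_linear_compose[OF bounded_linear_inner_left]) simp
  then have "\<forall>y. \<exists>z. \<forall>x. inner (T x) y = inner x z"
    using riesz_representation by blast
  then obtain S where S: "\<And>x y. inner (T x) y = inner x (S y)"
    by metis
  have cS: "cinner (T x) y = cinner x (S y)" for x y
  proof -
    have "Im (cinner (T x) y) = Im (cinner x (S y))"
      unfolding Im_cinner_left by (simp only: S[symmetric] bounded_clinear_scaleC[OF T])
    then show ?thesis
      using S by (simp add: complex_eq_iff inner_eq_Re_cinner)
  qed
  obtain B where B: "0 < B" "\<And>x. norm (T x) \<le> B * norm x"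
    using bounded_clinear_bound[OF T] by blast
  have "bounded_clinear S"
  proof (rule bounded_clinearI)
    show "S (x + y) = S x + S y" for x y
      by (rule cinner_eqI) (simp add: cS[symmetric] cinner_add_right)
    show "S (a *\<^sub>C x) = a *\<^sub>C S x" for a x
      by (rule cinner_eqI) (simp add: cS[symmetric] cinner_scaleC_right)
    show "norm (S y) \<le> norm y * B" for y
    proof -
      have "(norm (S y))\<^sup>2 = inner (T (S y)) y"
        by (simp add: S power2_norm_eq_inner)
      also have "\<dots> \<le> norm (T (S y)) * norm y"
        by (rule norm_cauchy_schwarz)
      also have "\<dots> \<le> (B * norm (S y)) * norm y"
        by (intro mult_right_mono B) simp
      finally have "norm (S y) * norm (S y) \<le> norm (S y) * (norm y * B)"
        by (simp add: power2_eq_square mult_ac)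
      then show ?thesis
        using B(1) by (cases "S y = 0") (auto simp: mult_le_cancel_left)
    qed
  qed
  with cS show ?thesis by blast
qed

lemma cadjoint_unique:
  fixes T :: "'a::complex_hilbert_space \<Rightarrow> 'a"
  assumes "bounded_clinear S" "\<And>x y. cinner (T x) y = cinner x (S y)"
  shows "cadjoint T = S"
  unfolding cadjoint_def
proof (rule the_equality)
  fix S' assume "bounded_clinear S' \<and> (\<forall>x y. cinner (T x) y = cinner x (S' y))"
  then have "S' y = S y" for y
    by (intro cinner_eqI) (simp add: assms(2)[symmetric])
  then show "S' = S" by blast
qed (use assms in blast)

lemma
  fixes T :: "'a::complex_hilbert_space \<Rightarrow> 'a"
  assumes "bounded_clinear T"
  shows bounded_clinear_cadjoint: "bounded_clinear (cadjoint T)"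
    and cinner_cadjoint: "cinner (T x) y = cinner x (cadjoint T y)"
  using cadjoint_exists[OF assms] cadjoint_unique by metis+

section \<open>Positive operators\<close>

lemma positive_op_bounded_clinear: "positive_op A \<Longrightarrow> bounded_clinear A"
  by (simp add: positive_op_def)

lemma positive_op_nonneg: "positive_op A \<Longrightarrow> 0 \<le> inner (A x) x"
  by (simp add: positive_op_def inner_eq_Re_cinner)

text \<open>
  Polarisation: the quadratic form is real at \<open>x + y\<close> and at \<open>\<i> *\<^sub>C x + y\<close>, which determines the
  imaginary and the real part of the difference between the form and its conjugate transpose.
\<close>

lemma positive_op_selfadjoint:
  assumes A: "positive_op A"
  shows "cinner (A x) y = cinner x (A y)"
proof -
  note lin = bounded_clinear_simps[OF positive_op_bounded_clinear[OF A]]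
  have real: "Im (cinner (A z) z) = 0" for z
    using A complex_is_Real_iff unfolding positive_op_def by blast
  have "Im (cinner (A x) y) + Im (cinner (A y) x) = 0"
    using real[of "x + y"] real[of x] real[of y]
    by (simp add: lin cinner_add_left cinner_add_right)
  moreover have "Re (cinner (A x) y) - Re (cinner (A y) x) = 0"
    using real[of "\<i> *\<^sub>C x + y"] real[of x] real[of y]
    by (simp add: lin cinner_add_left cinner_add_right cinner_scaleC_left cinner_scaleC_right)
  ultimately have "cinner (A x) y = cnj (cinner (A y) x)"
    by (simp add: complex_eq_iff)
  then show ?thesis
    by (metis cinner_commute)
qed

lemma positive_op_inner_selfadjoint: "positive_op A \<Longrightarrow> inner (A x) y = inner x (A y)"
  by (simp add: positive_op_selfadjoint inner_eq_Re_cinner)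

text \<open>
  Otherwise the form would be negative at \<open>y + t *\<^sub>R A y\<close> for a small negative \<open>t\<close>, where the linear
  term \<open>2 * t * (norm (A y))\<^sup>2\<close> dominates the quadratic one.
\<close>

lemma positive_op_kernel:
  assumes A: "positive_op A" and 0: "inner (A y) y = 0"
  shows "A y = 0"
proof (rule ccontr)
  assume "A y \<noteq> 0"
  note lin = bounded_clinear_simps[OF positive_op_bounded_clinear[OF A]]
  define b where "b = inner (A (A y)) (A y)"
  define n where "n = inner (A y) (A y)"
  have "n > 0" "b \<ge> 0"
    using \<open>A y \<noteq> 0\<close> positive_op_nonneg[OF A] by (auto simp: b_def n_def)
  \<comment> \<open>small enough that \<open>t * b\<close> stays above \<open>- n\<close>; the summand 1 covers \<open>b = 0\<close>\<close>
  define t where "t = - n / (b + 1)"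
  have "0 \<le> inner (A (y + t *\<^sub>R A y)) (y + t *\<^sub>R A y)"
    by (rule positive_op_nonneg[OF A])
  also have "\<dots> = t * (2 * n + t * b)"
    using positive_op_inner_selfadjoint[OF A, of "A y" y] 0
    by (simp add: lin inner_add_left inner_add_right b_def n_def inner_commute algebra_simps)
  finally have "0 \<le> t * (2 * n + t * b)" .
  moreover have "t < 0"
    using \<open>n > 0\<close> \<open>b \<ge> 0\<close> by (simp add: t_def)
  ultimately have "2 * n + t * b \<le> 0"
    by (simp add: zero_le_mult_iff)
  moreover have "t * b \<ge> - n"
    using \<open>n > 0\<close> \<open>b \<ge> 0\<close> by (simp add: t_def field_simps)
  ultimately show False
    using \<open>n > 0\<close> by simp
qed


section \<open>The positive square root\<close>

text \<open>
  The square root of \<open>A\<close> is sought as \<open>I - Y\<close>. With \<open>B = I - A\<close>, the equation \<open>(I - Y)\<^sup>2 = A\<close> says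
  \<open>Y = (B + Y\<^sup>2) / 2\<close>, and the iteration below is the fixed-point iteration for this equation started
  at \<open>0\<close>. Replacing \<open>B\<close> by the number 1 gives a bounded increasing sequence, and this scalar
  sequence dominates the operator iteration, both its size and its increments, when \<open>B\<close> is a
  contraction.
\<close>

primrec sqrt_iter :: "('a::real_vector \<Rightarrow> 'a) \<Rightarrow> nat \<Rightarrow> 'a \<Rightarrow> 'a" where
  "sqrt_iter B 0 = (\<lambda>x. 0)"
| "sqrt_iter B (Suc n) = (\<lambda>x. (1/2) *\<^sub>R (B x + sqrt_iter B n (sqrt_iter B n x)))"

primrec sqrt_majorant :: "nat \<Rightarrow> real" where
  "sqrt_majorant 0 = 0"
| "sqrt_majorant (Suc n) = (1 + (sqrt_majorant n)\<^sup>2) / 2"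

lemma sqrt_majorant_bounds: "0 \<le> sqrt_majorant n \<and> sqrt_majorant n \<le> 1"
  by (induction n) (auto simp: power_le_one)

lemma sqrt_majorant_step: "sqrt_majorant n \<le> sqrt_majorant (Suc n)"
  using zero_le_power2[of "1 - sqrt_majorant n"] by (simp add: power2_eq_square algebra_simps)

lemma sqrt_majorant_Cauchy: "Cauchy sqrt_majorant"
proof (intro convergent_Cauchy Bseq_monoseq_convergent)
  show "Bseq sqrt_majorant"
    using sqrt_majorant_bounds by (intro BseqI'[of _ 1]) (simp add: abs_le_iff)
  show "monoseq sqrt_majorant"
    by (intro incseq_imp_monoseq incseq_SucI sqrt_majorant_step)
qed

lemma bounded_clinear_sqrt_iter:
  "bounded_clinear B \<Longrightarrow> bounded_clinear (sqrt_iter B n)"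
proof (induction n)
  case 0
  show ?case by (auto intro: bounded_clinearI[where B = 0])
next
  case (Suc n)
  then show ?case
    unfolding sqrt_iter.simps
    by (intro bounded_clinear_scaleR_op bounded_clinear_add_op
        bounded_clinear_comp[of "sqrt_iter B n" "sqrt_iter B n"])
qed

lemma sqrt_iter_commute:
  assumes "bounded_clinear C" "\<And>x. C (B x) = B (C x)"
  shows "C (sqrt_iter B n x) = sqrt_iter B n (C x)"
  using assms(2)
  by (induction n arbitrary: x) (simp_all add: bounded_clinear_simps[OF assms(1)])

lemma sqrt_iter_norm_le:
  assumes "\<And>x. norm (B x) \<le> norm x"
  shows "norm (sqrt_iter B n x) \<le> sqrt_majorant n * norm x"
proof (induction n arbitrary: x)
  case (Suc n)
  have le: "norm (B x + sqrt_iter B n (sqrt_iter B n x))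
      \<le> norm x + sqrt_majorant n * (sqrt_majorant n * norm x)"
    using Suc.IH[of "sqrt_iter B n x"] Suc.IH[of x] sqrt_majorant_bounds[of n] assms[of x]
    by (smt (verit) mult_left_mono norm_triangle_ineq)
  have iter: "norm (sqrt_iter B (Suc n) x)
      = (1/2) * norm (B x + sqrt_iter B n (sqrt_iter B n x))"
    unfolding sqrt_iter.simps norm_scaleR by simp
  have majorant: "sqrt_majorant (Suc n) * norm x
      = (1/2) * (norm x + sqrt_majorant n * (sqrt_majorant n * norm x))"
    by (simp add: power2_eq_square field_simps)
  show ?case
    unfolding iter majorant by (intro mult_left_mono le) simp
qed simp

text \<open>
  The iterates commute with each other, so the difference of two squares factors, and the
  induction hypothesis is applied at the sum of the values of two consecutive iterates. The scalar increments factor in the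
  same way, so the bounds match exactly.
\<close>

lemma sqrt_iter_step_norm_le:
  assumes B: "bounded_clinear B" and le: "\<And>x. norm (B x) \<le> norm x"
  shows "norm (sqrt_iter B (Suc n) x - sqrt_iter B n x)
      \<le> (sqrt_majorant (Suc n) - sqrt_majorant n) * norm x"
proof (induction n arbitrary: x)
  case 0
  show ?case using le[of x] by simp
next
  case (Suc n)
  let ?Y = "sqrt_iter B n" and ?Z = "sqrt_iter B (Suc n)"
  let ?y = "sqrt_majorant n" and ?z = "sqrt_majorant (Suc n)"
  have "B (?Z x) = ?Z (B x)" for x
    by (rule sqrt_iter_commute) (auto simp: B)
  then have comm: "?Z (?Y x) = ?Y (?Z x)"
    by (intro sqrt_iter_commute bounded_clinear_sqrt_iter B) simp
  have lin: "?Y (u + v) = ?Y u + ?Y v" "?Z (u + v) = ?Z u + ?Z v" for u v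
    using bounded_clinear_add[OF bounded_clinear_sqrt_iter[OF B]] by blast+
  have diff: "a - c = (1/2) *\<^sub>R (z - y)"
    if "a = (1/2) *\<^sub>R (b + z)" "c = (1/2) *\<^sub>R (b + y)" for a b c y z :: 'a
    by (simp add: that algebra_simps)
  have "sqrt_iter B (Suc (Suc n)) x - ?Z x = (1/2) *\<^sub>R (?Z (?Z x) - ?Y (?Y x))"
    by (rule diff[of _ "B x"]) (simp_all only: sqrt_iter.simps)
  also have "?Z (?Z x) - ?Y (?Y x) = ?Z (?Z x + ?Y x) - ?Y (?Z x + ?Y x)"
    by (simp only: lin comm) simp
  finally have "norm (sqrt_iter B (Suc (Suc n)) x - ?Z x)
      = (1/2) * norm (?Z (?Z x + ?Y x) - ?Y (?Z x + ?Y x))"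
    by simp
  also have "\<dots> \<le> (1/2) * ((?z - ?y) * norm (?Z x + ?Y x))"
    by (intro mult_left_mono Suc.IH) simp
  also have "\<dots> \<le> (1/2) * ((?z - ?y) * ((?z + ?y) * norm x))"
  proof -
    have "norm (?Z x + ?Y x) \<le> (?z + ?y) * norm x"
      using norm_triangle_ineq[of "?Z x" "?Y x"] sqrt_iter_norm_le[OF le, of "Suc n" x]
        sqrt_iter_norm_le[OF le, of n x]
      by (simp only: distrib_right)
    then show ?thesis
      using sqrt_majorant_step[of n] by (intro mult_left_mono) auto
  qed
  also have "\<dots> = (sqrt_majorant (Suc (Suc n)) - ?z) * norm x"
  proof -
    have "(1/2) * ((z - y) * (z + y)) = a - c"
      if "a = (1 + z\<^sup>2) / 2" "c = (1 + y\<^sup>2) / 2" for a c y z :: real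
      by (simp add: that power2_eq_square algebra_simps add_divide_distrib diff_divide_distrib)
    from this[of "sqrt_majorant (Suc (Suc n))" ?z ?z ?y] show ?thesis
      by (simp only: sqrt_majorant.simps mult.assoc[symmetric])
  qed
  finally show ?case .
qed

lemma sqrt_iter_diff_norm_le:
  assumes "bounded_clinear B" "\<And>x. norm (B x) \<le> norm x" "m \<le> n"
  shows "norm (sqrt_iter B n x - sqrt_iter B m x)
      \<le> (sqrt_majorant n - sqrt_majorant m) * norm x"
  using \<open>m \<le> n\<close>
proof (induction n rule: dec_induct)
  case (step n)
  then show ?case
    using norm_triangle_ineq[of "sqrt_iter B (Suc n) x - sqrt_iter B n x"
        "sqrt_iter B n x - sqrt_iter B m x"] sqrt_iter_step_norm_le[OF assms(1,2), of n x]
    by (simp del: sqrt_iter.simps sqrt_majorant.simps add: algebra_simps)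
qed simp

lemma sqrt_iter_convergent:
  fixes B :: "'a::complex_hilbert_space \<Rightarrow> 'a"
  assumes "bounded_clinear B" "\<And>x. norm (B x) \<le> norm x"
  shows "convergent (\<lambda>n. sqrt_iter B n x)"
proof -
  have le: "dist (sqrt_iter B m x) (sqrt_iter B n x)
      \<le> dist (sqrt_majorant m) (sqrt_majorant n) * norm x" for m n
  proof (induction m n rule: linorder_wlog)
    case (le m n)
    then have "sqrt_majorant m \<le> sqrt_majorant n"
      by (meson incseqD incseq_SucI sqrt_majorant_step)
    then have "dist (sqrt_majorant m) (sqrt_majorant n) = sqrt_majorant n - sqrt_majorant m"
      by (simp add: dist_real_def)
    then show ?case
      using sqrt_iter_diff_norm_le[OF assms le, of x]
      by (simp add: dist_norm norm_minus_commute)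
  qed (simp add: dist_commute)
  have "Cauchy (\<lambda>n. sqrt_iter B n x)"
  proof (rule metric_CauchyI)
    fix e :: real assume "0 < e"
    then have "0 < e / (norm x + 1)"
      by (simp add: add_nonneg_pos)
    then obtain N where N: "\<And>m n. m \<ge> N \<Longrightarrow> n \<ge> N \<Longrightarrow>
        dist (sqrt_majorant m) (sqrt_majorant n) < e / (norm x + 1)"
      using metric_CauchyD[OF sqrt_majorant_Cauchy] by metis
    have "dist (sqrt_iter B m x) (sqrt_iter B n x) < e" if "m \<ge> N" "n \<ge> N" for m n
    proof -
      have "dist (sqrt_iter B m x) (sqrt_iter B n x)
          \<le> dist (sqrt_majorant m) (sqrt_majorant n) * (norm x + 1)"
        using le[of m n] zero_le_dist[of "sqrt_majorant m" "sqrt_majorant n"]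
        by (simp only: distrib_left)
      also have "\<dots> < e"
        using N[OF that] by (simp add: pos_less_divide_eq add_nonneg_pos)
      finally show ?thesis .
    qed
    then show "\<exists>N. \<forall>m\<ge>N. \<forall>n\<ge>N. dist (sqrt_iter B m x) (sqrt_iter B n x) < e"
      by blast
  qed
  then show ?thesis
    by (simp add: Cauchy_convergent_iff)
qed

text \<open>
  The last property states that the root commutes with every operator commuting with \<open>A\<close>;
  it is inherited from the iterates and is what makes the root unique.
\<close>

lemma positive_sqrt_of_near_identity:
  fixes A :: "'a::complex_hilbert_space \<Rightarrow> 'a"
  assumes A: "bounded_clinear A" and sa: "\<And>x y. cinner (A x) y = cinner x (A y)"
    and le: "\<And>x. norm (x - A x) \<le> norm x"
  obtains P where "positive_op P" "\<And>x. P (P x) = A x"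
    "\<And>C x. bounded_clinear C \<Longrightarrow> (\<And>x. C (A x) = A (C x)) \<Longrightarrow> C (P x) = P (C x)"
proof -
  define B where "B = (\<lambda>x. x - A x)"
  have B: "bounded_clinear B"
    unfolding B_def by (intro bounded_clinear_diff_op bounded_clinear_ident A)
  have leB: "norm (B x) \<le> norm x" for x
    using le by (simp add: B_def)
  note linY = bounded_clinear_simps[OF bounded_clinear_sqrt_iter[OF B]]
  define Y where "Y x = lim (\<lambda>n. sqrt_iter B n x)" for x
  have Y: "(\<lambda>n. sqrt_iter B n x) \<longlonglongrightarrow> Y x" for x
    using sqrt_iter_convergent[OF B leB] by (simp add: Y_def convergent_LIMSEQ_iff)
  have iter_le: "norm (sqrt_iter B n x) \<le> norm x" for n x
    using sqrt_iter_norm_le[OF leB, of n x] sqrt_majorant_bounds[of n]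
    by (smt (verit) mult_left_le_one_le norm_ge_zero)
  have Y_le: "norm (Y x) \<le> norm x" for x
    by (rule LIMSEQ_le_const2[OF tendsto_norm[OF Y]]) (auto intro: iter_le)
  have bcY: "bounded_clinear Y"
  proof (rule bounded_clinearI)
    show "Y (x + y) = Y x + Y y" for x y
      using tendsto_add[OF Y[of x] Y[of y]] Y[of "x + y"]
      by (simp add: linY LIMSEQ_unique)
    show "norm (Y x) \<le> norm x * 1" for x
      using Y_le by simp
    show "Y (a *\<^sub>C x) = a *\<^sub>C Y x" for a x
    proof -
      have "bounded_linear (\<lambda>x::'a. a *\<^sub>C x)"
        by (rule bounded_linear_scaleC)
      from bounded_linear.tendsto[OF this Y[of x]] Y[of "a *\<^sub>C x"] show ?thesis
        by (simp add: linY LIMSEQ_unique)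
    qed
  qed
  have Y_eq: "2 *\<^sub>R Y x = B x + Y (Y x)" for x
  proof -
    have "(\<lambda>n. sqrt_iter B n (sqrt_iter B n x - Y x)) \<longlonglongrightarrow> 0"
    proof (rule Lim_null_comparison)
      show "\<forall>\<^sub>F n in sequentially. norm (sqrt_iter B n (sqrt_iter B n x - Y x))
          \<le> norm (sqrt_iter B n x - Y x)"
        by (simp add: iter_le)
      show "(\<lambda>n. norm (sqrt_iter B n x - Y x)) \<longlonglongrightarrow> 0"
        by (rule tendsto_norm_zero[OF LIM_zero[OF Y[of x]]])
    qed
    from tendsto_add[OF this Y[of "Y x"]]
    have "(\<lambda>n. sqrt_iter B n (sqrt_iter B n x)) \<longlonglongrightarrow> Y (Y x)"
      by (simp add: linY)
    then have "(\<lambda>n. sqrt_iter B (Suc n) x) \<longlonglongrightarrow> (1/2) *\<^sub>R (B x + Y (Y x))"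
      unfolding sqrt_iter.simps by (intro tendsto_intros)
    moreover have "(\<lambda>n. sqrt_iter B (Suc n) x) \<longlonglongrightarrow> Y x"
      using Y by (rule LIMSEQ_Suc)
    ultimately have "Y x = (1/2) *\<^sub>R (B x + Y (Y x))"
      using LIMSEQ_unique by blast
    then have "2 *\<^sub>R Y x = 2 *\<^sub>R ((1/2) *\<^sub>R (B x + Y (Y x)))"
      by (rule arg_cong)
    then show ?thesis by simp
  qed
  have saB: "cinner (B x) y = cinner x (B y)" for x y
    by (simp add: B_def cinner_diff_left cinner_diff_right sa)
  have sa_iter: "cinner (sqrt_iter B n x) y = cinner x (sqrt_iter B n y)" for n x y
    by (induction n arbitrary: x y)
      (simp_all add: scaleR_scaleC cinner_scaleC_left cinner_scaleC_right cinner_add_left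
        cinner_add_right saB)
  have saY: "cinner (Y x) y = cinner x (Y y)" for x y
  proof -
    have in_eq: "inner (Y x) y = inner x (Y y)" for x y
    proof -
      have "(\<lambda>n. inner (sqrt_iter B n x) y) \<longlonglongrightarrow> inner (Y x) y"
        by (intro tendsto_intros Y)
      moreover have "(\<lambda>n. inner (sqrt_iter B n x) y) \<longlonglongrightarrow> inner x (Y y)"
        unfolding inner_eq_Re_cinner sa_iter
        unfolding inner_eq_Re_cinner[symmetric] by (intro tendsto_intros Y)
      ultimately show ?thesis
        using LIMSEQ_unique by blast
    qed
    have "Im (cinner (Y x) y) = Im (cinner x (Y y))"
      unfolding Im_cinner_left by (simp only: in_eq[symmetric] bounded_clinear_scaleC[OF bcY])
    then show ?thesis
      using in_eq by (simp add: complex_eq_iff inner_eq_Re_cinner)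
  qed
  define P where "P = (\<lambda>x. x - Y x)"
  have "positive_op P"
    unfolding positive_op_def
  proof (intro conjI allI)
    show "bounded_clinear P"
      unfolding P_def by (intro bounded_clinear_diff_op bounded_clinear_ident bcY)
    have saP: "cinner (P x) y = cinner x (P y)" for x y
      by (simp add: P_def cinner_diff_left cinner_diff_right saY)
    show "cinner (P x) x \<in> \<real>" for x
      by (metis saP cinner_commute Reals_cnj_iff)
    have "inner (Y x) x \<le> norm x * norm x" for x
      using norm_cauchy_schwarz[of "Y x" x] mult_right_mono[OF Y_le[of x], of "norm x"] by simp
    then show "0 \<le> Re (cinner (P x) x)" for x
      unfolding inner_eq_Re_cinner[symmetric] P_def
      by (simp add: inner_diff_left norm_eq_sqrt_inner)
  qed
  moreover have "P (P x) = A x" for x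
    using Y_eq[of x]
    by (simp add: P_def B_def bounded_clinear_simps[OF bcY] scaleR_2 algebra_simps)
  moreover have "C (P x) = P (C x)"
    if C: "bounded_clinear C" and CA: "\<And>x. C (A x) = A (C x)" for C x
  proof -
    have "C (B x) = B (C x)" for x
      by (simp add: B_def CA bounded_clinear_simps[OF C])
    then have "C (sqrt_iter B n x) = sqrt_iter B n (C x)" for n
      by (rule sqrt_iter_commute[OF C])
    moreover have "(\<lambda>n. C (sqrt_iter B n x)) \<longlonglongrightarrow> C (Y x)"
      using C Y by (auto simp: bounded_clinear_def intro: bounded_linear.tendsto)
    ultimately have "C (Y x) = Y (C x)"
      using Y[of "C x"] LIMSEQ_unique by auto
    then show ?thesis
      by (simp add: P_def bounded_clinear_simps[OF C])
  qed
  ultimately show thesis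
    using that by blast
qed

text \<open>
  The previous lemma covers operators within distance 1 of the identity. A small multiple
  \<open>e A\<close> of \<open>A = S\<^sup>* S\<close> is such an operator: if \<open>b\<close> bounds the adjoint of \<open>S\<close>, then
  \<open>(norm (A x))\<^sup>2 \<le> b\<^sup>2 * inner (A x) x\<close>, so for \<open>e = 1 / b\<^sup>2\<close> the term that is linear in \<open>e\<close> in
  the expansion of \<open>(norm (x - e *\<^sub>R A x))\<^sup>2\<close> outweighs the quadratic one. The root is then
  multiplied by \<open>b\<close>.
\<close>

lemma cadjoint_comp_sqrt:
  fixes S :: "'a::complex_hilbert_space \<Rightarrow> 'a"
  assumes S: "bounded_clinear S"
  obtains P where "positive_op P" "\<And>x. P (P x) = cadjoint S (S x)"
    "\<And>C x. bounded_clinear C \<Longrightarrow> (\<And>x. C (cadjoint S (S x)) = cadjoint S (S (C x))) \<Longrightarrow>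
      C (P x) = P (C x)"
proof -
  define A where "A = (\<lambda>x. cadjoint S (S x))"
  note bS' = bounded_clinear_cadjoint[OF S]
  have A: "bounded_clinear A"
    unfolding A_def by (rule bounded_clinear_comp[OF bS' S])
  have S': "cinner (cadjoint S x) y = cinner x (S y)" for x y
    by (metis cinner_cadjoint[OF S] cinner_commute)
  have saA: "cinner (A x) y = cinner x (A y)" for x y
    by (simp add: A_def S' cinner_cadjoint[OF S])
  obtain b where b: "0 < b" "\<And>x. norm (cadjoint S x) \<le> b * norm x"
    using bounded_clinear_bound[OF bS'] by blast
  define e where "e = 1 / b\<^sup>2"
  have e: "0 < e" using b by (simp add: e_def)
  have "norm (x - e *\<^sub>R A x) \<le> norm x" for x
  proof -
    have "inner (A x) x = (norm (S x))\<^sup>2"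
      using S'[of "S x" x] by (simp add: A_def inner_eq_Re_cinner power2_norm_eq_inner)
    moreover have "(norm (A x))\<^sup>2 \<le> b\<^sup>2 * (norm (S x))\<^sup>2"
      using b(2)[of "S x"] by (metis A_def norm_ge_zero power_mono power_mult_distrib)
    ultimately have "e * (norm (A x))\<^sup>2 \<le> inner (A x) x"
      using b by (simp add: e_def field_simps)
    then have "e * (e * (norm (A x))\<^sup>2) \<le> e * inner (A x) x"
      using e by (intro mult_left_mono) auto
    moreover have "(norm (x - e *\<^sub>R A x))\<^sup>2
        = (norm x)\<^sup>2 - 2 * (e * inner (A x) x) + e * (e * (norm (A x))\<^sup>2)"
      unfolding power2_norm_eq_inner
      by (simp add: inner_diff_left inner_diff_right inner_commute algebra_simps)
    moreover have "0 \<le> e * inner (A x) x"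
      using e \<open>inner (A x) x = _\<close> by simp
    ultimately have "(norm (x - e *\<^sub>R A x))\<^sup>2 \<le> (norm x)\<^sup>2"
      by linarith
    then show ?thesis
      by (rule power2_le_imp_le) simp
  qed
  moreover have "cinner (e *\<^sub>R A x) y = cinner x (e *\<^sub>R A y)" for x y
    by (simp add: scaleR_scaleC cinner_scaleC_left cinner_scaleC_right saA)
  ultimately obtain Q where Q: "positive_op Q" "\<And>x. Q (Q x) = e *\<^sub>R A x"
    "\<And>C x. bounded_clinear C \<Longrightarrow> (\<And>x. C (e *\<^sub>R A x) = e *\<^sub>R A (C x)) \<Longrightarrow> C (Q x) = Q (C x)"
    using positive_sqrt_of_near_identity[OF bounded_clinear_scaleR_op[OF A, of e]] by blast
  note linQ = bounded_clinear_simps[OF positive_op_bounded_clinear[OF Q(1)]]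
  define P where "P = (\<lambda>x. b *\<^sub>R Q x)"
  show thesis
  proof (rule that)
    show "positive_op P"
      using Q(1) b(1) unfolding positive_op_def P_def
      by (simp add: bounded_clinear_scaleR_op) (simp add: scaleR_scaleC cinner_scaleC_left)
    show "P (P x) = cadjoint S (S x)" for x
      using b(1) by (simp add: P_def linQ Q(2) e_def power2_eq_square A_def)
    show "C (P x) = P (C x)"
      if C: "bounded_clinear C" and "\<And>x. C (cadjoint S (S x)) = cadjoint S (S (C x))" for C x
    proof -
      have "C (e *\<^sub>R A x) = e *\<^sub>R A (C x)" for x
        using that(2) by (simp add: bounded_clinear_scaleR[OF C] A_def)
      then have "C (Q x) = Q (C x)"
        by (rule Q(3)[OF C])
      then show ?thesis
        by (simp add: P_def bounded_clinear_scaleR[OF C])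
    qed
  qed
qed

text \<open>
  For \<open>y = P x - Q x\<close> commutation gives \<open>(P + Q) y = (P\<^sup>2 - Q\<^sup>2) x = 0\<close>. By positivity both
  \<open>P y\<close> and \<open>Q y\<close> vanish, and then \<open>inner y y = inner x (P y - Q y) = 0\<close>.
\<close>

lemma commuting_positive_sqrt_unique:
  assumes P: "positive_op P" and Q: "positive_op Q"
    and sq: "\<And>x. P (P x) = Q (Q x)" and comm: "\<And>x. Q (P x) = P (Q x)"
  shows "P = Q"
proof
  fix x
  note lin = bounded_clinear_simps[OF positive_op_bounded_clinear[OF P]]
    bounded_clinear_simps[OF positive_op_bounded_clinear[OF Q]]
  define y where "y = P x - Q x"
  have "P y + Q y = 0"
    by (simp add: y_def lin sq comm)
  then have "inner (P y) y + inner (Q y) y = 0"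
    by (simp add: inner_add_left[symmetric])
  then have "inner (P y) y = 0" "inner (Q y) y = 0"
    using positive_op_nonneg[OF P, of y] positive_op_nonneg[OF Q, of y] by linarith+
  then have "P y = 0" "Q y = 0"
    using positive_op_kernel P Q by blast+
  then have "inner y y = 0"
    using positive_op_inner_selfadjoint[OF P, of x y] positive_op_inner_selfadjoint[OF Q, of x y]
    by (subst y_def) (simp add: inner_diff_left)
  then show "P x = Q x"
    by (simp add: y_def)
qed

lemma
  fixes S :: "'a::complex_hilbert_space \<Rightarrow> 'a"
  assumes S: "bounded_clinear S"
  shows positive_op_abs: "positive_op (op_abs S)"
    and op_abs_square: "op_abs S (op_abs S x) = cadjoint S (S x)"
proof -
  obtain P where P: "positive_op P" "\<And>x. P (P x) = cadjoint S (S x)"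
    "\<And>C x. bounded_clinear C \<Longrightarrow> (\<And>x. C (cadjoint S (S x)) = cadjoint S (S (C x))) \<Longrightarrow>
      C (P x) = P (C x)"
    using cadjoint_comp_sqrt[OF S] by blast
  have "op_abs S = P"
    unfolding op_abs_def op_sqrt_def
  proof (rule the_equality)
    show "positive_op P \<and> P \<circ> P = cadjoint S \<circ> S"
      using P by (simp add: fun_eq_iff)
    fix Q assume "positive_op Q \<and> Q \<circ> Q = cadjoint S \<circ> S"
    then have Q: "positive_op Q" "\<And>x. Q (Q x) = cadjoint S (S x)"
      by (simp_all add: fun_eq_iff)
    have "Q (P x) = P (Q x)" for x
      by (intro P(3) positive_op_bounded_clinear Q(1)) (simp flip: Q(2))
    then show "Q = P"
      using commuting_positive_sqrt_unique[OF P(1) Q(1)] P(2) Q(2) by metis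
  qed
  then show "positive_op (op_abs S)" "op_abs S (op_abs S x) = cadjoint S (S x)"
    using P by simp_all
qed


section \<open>Eigenvalues of a positive operator\<close>

text \<open>
  For a positive operator these are all eigenvalues; as real numbers they can be compared and
  mapped by real functions.
\<close>

definition real_eigenvalues :: "('a::real_vector \<Rightarrow> 'a) \<Rightarrow> real set" where
  "real_eigenvalues A = {r. \<exists>x. x \<noteq> 0 \<and> A x = r *\<^sub>R x}"

lemma point_spectrum_iff:
  assumes "bounded_clinear S"
  shows "\<mu> \<in> point_spectrum S \<longleftrightarrow> (\<exists>x. x \<noteq> 0 \<and> S x = \<mu> *\<^sub>C x)"
proof -
  have "inj (\<lambda>x. S x - \<mu> *\<^sub>C x) \<longleftrightarrow> (\<forall>x. S x - \<mu> *\<^sub>C x = 0 \<longrightarrow> x = 0)"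
  proof
    assume "inj (\<lambda>x. S x - \<mu> *\<^sub>C x)"
    then show "\<forall>x. S x - \<mu> *\<^sub>C x = 0 \<longrightarrow> x = 0"
      by (metis (no_types, lifting) assms bounded_clinear_zero complex_vector.scale_zero_right
          diff_zero injD)
  next
    assume ker: "\<forall>x. S x - \<mu> *\<^sub>C x = 0 \<longrightarrow> x = 0"
    show "inj (\<lambda>x. S x - \<mu> *\<^sub>C x)"
    proof (rule injI)
      fix x y assume "S x - \<mu> *\<^sub>C x = S y - \<mu> *\<^sub>C y"
      then have "S (x - y) - \<mu> *\<^sub>C (x - y) = 0"
        by (simp add: bounded_clinear_diff[OF assms] complex_vector.scale_right_diff_distrib
            algebra_simps)
      then show "x = y"
        using ker by fastforce
    qed
  qed
  then show ?thesis
    by (auto simp: point_spectrum_def)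
qed

text \<open>
  Factor \<open>A\<^sup>2 - n\<^sup>2 I\<close> as \<open>(A + n I) (A - n I)\<close>: for \<open>n > 0\<close> the first factor is injective by
  positivity of \<open>A\<close>, so \<open>x\<close> is an eigenvector of \<open>A\<close> itself.
\<close>

lemma positive_op_square_eigenvector:
  assumes A: "positive_op A" and "x \<noteq> 0" and eq: "A (A x) = \<nu> *\<^sub>C x"
  obtains n where "0 \<le> n" "\<nu> = complex_of_real (n\<^sup>2)" "A x = n *\<^sub>R x"
proof -
  note lin = bounded_clinear_simps[OF positive_op_bounded_clinear[OF A]]
  \<comment> \<open>forced by \<open>(norm (A x))\<^sup>2 = \<nu> * (norm x)\<^sup>2\<close>, which is the pairing of \<open>A (A x)\<close> with \<open>x\<close>\<close>
  define n where "n = norm (A x) / norm x"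
  have "\<nu> * complex_of_real ((norm x)\<^sup>2) = cinner (A (A x)) x"
    by (simp only: eq cinner_scaleC_left cinner_self)
  also have "\<dots> = complex_of_real ((norm (A x))\<^sup>2)"
    by (simp only: positive_op_selfadjoint[OF A] cinner_self)
  finally have \<nu>: "\<nu> = complex_of_real (n\<^sup>2)"
    using \<open>x \<noteq> 0\<close> by (simp add: n_def field_simps)
  define y where "y = A x - n *\<^sub>R x"
  have n: "0 \<le> n" by (simp add: n_def)
  have sq: "A (A x) = n\<^sup>2 *\<^sub>R x"
    by (simp add: eq \<nu> scaleR_scaleC)
  have "A y + n *\<^sub>R y = 0"
    by (simp add: y_def lin sq power2_eq_square algebra_simps)
  then have "inner (A y) y + n * inner y y = 0"
    by (metis inner_add_left inner_scaleR_left inner_zero_left)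
  moreover have "0 \<le> inner (A y) y" "0 \<le> n * inner y y"
    using positive_op_nonneg[OF A] n by auto
  ultimately have "n * inner y y = 0"
    by linarith
  moreover have "y = 0" if "n = 0"
    using that \<open>x \<noteq> 0\<close> by (simp add: y_def n_def)
  ultimately have "A x = n *\<^sub>R x"
    by (auto simp: y_def)
  with n \<nu> show thesis by (rule that)
qed

lemma positive_op_eigenvector:
  assumes A: "positive_op A" and "x \<noteq> 0" and eq: "A x = \<mu> *\<^sub>C x"
  obtains r where "0 \<le> r" "\<mu> = complex_of_real r" "A x = r *\<^sub>R x"
proof -
  have "cinner (A x) x = \<mu> * complex_of_real ((norm x)\<^sup>2)"
    by (simp only: eq cinner_scaleC_left cinner_self)
  moreover have "cinner (A x) x \<in> \<real>" "0 \<le> Re (cinner (A x) x)"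
    using A by (auto simp: positive_op_def)
  ultimately have "Im \<mu> = 0" "0 \<le> Re \<mu>"
    using \<open>x \<noteq> 0\<close> by (auto simp: complex_is_Real_iff zero_le_mult_iff)
  moreover from this have "\<mu> = complex_of_real (Re \<mu>)"
    by (simp add: complex_eq_iff)
  ultimately show thesis
    using that[of "Re \<mu>"] eq by (simp add: scaleR_scaleC)
qed

lemma real_eigenvalues_nonneg:
  assumes "positive_op A" "r \<in> real_eigenvalues A"
  shows "0 \<le> r"
  using assms positive_op_eigenvector[OF assms(1), of _ "complex_of_real r"]
  by (auto simp: real_eigenvalues_def scaleR_scaleC)

lemma positive_op_eigenvectors_iff:
  assumes "positive_op A"
  shows "x \<in> eigenvectors A \<longleftrightarrow> x \<noteq> 0 \<and> (\<exists>r. A x = r *\<^sub>R x)"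
  unfolding eigenvectors_def mem_Collect_eq
  by (metis assms positive_op_eigenvector scaleR_scaleC)

lemma positive_op_point_spectrum:
  assumes A: "positive_op A"
  shows "point_spectrum A = complex_of_real ` real_eigenvalues A"
proof (rule set_eqI)
  fix \<mu>
  have "(\<exists>x. x \<noteq> 0 \<and> A x = \<mu> *\<^sub>C x) \<longleftrightarrow>
      (\<exists>r x. \<mu> = complex_of_real r \<and> x \<noteq> 0 \<and> A x = r *\<^sub>R x)"
    by (metis A positive_op_eigenvector scaleR_scaleC)
  then show "\<mu> \<in> point_spectrum A \<longleftrightarrow> \<mu> \<in> complex_of_real ` real_eigenvalues A"
    unfolding real_eigenvalues_def point_spectrum_iff[OF positive_op_bounded_clinear[OF A]]
    by blast
qed

lemma positive_op_eigenvectors_orthogonal: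
  assumes A: "positive_op A" and "A x = r *\<^sub>R x" "A y = s *\<^sub>R y" "r \<noteq> s"
  shows "cinner x y = 0"
proof -
  have "complex_of_real r * cinner x y = complex_of_real s * cinner x y"
    using positive_op_selfadjoint[OF A, of x y] assms(2,3)
    by (simp add: scaleR_scaleC cinner_scaleC_left cinner_scaleC_right)
  then show ?thesis
    using \<open>r \<noteq> s\<close> by simp
qed

text \<open>
  A vector in the span is a finite sum of eigenvectors for distinct eigenvalues. These are
  orthogonal, so by Pythagoras the bound on each eigenvalue passes to the sum.
\<close>

lemma positive_op_norm_le_on_span:
  assumes A: "positive_op A"
    and X: "\<And>x. x \<in> X \<Longrightarrow> \<exists>r. A x = r *\<^sub>R x \<and> 0 \<le> r \<and> r \<le> N"
    and "y \<in> complex_vector.span X"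
  shows "norm (A y) \<le> N * norm y"
proof -
  note bA = positive_op_bounded_clinear[OF A]
  note lin = bounded_clinear_simps[OF bA]
  \<comment> \<open>\<open>v r\<close> is the component of \<open>y\<close> in the eigenspace of \<open>r\<close>, and \<open>F\<close> contains its support\<close>
  have "\<exists>F v. finite F \<and> (\<forall>r. A (v r) = r *\<^sub>R v r) \<and> (\<forall>r\<in>F. 0 \<le> r \<and> r \<le> N) \<and>
      (\<forall>r. r \<notin> F \<longrightarrow> v r = 0) \<and> y = (\<Sum>r\<in>F. v r)"
    using assms(3)
  proof (induction rule: complex_vector.span_induct_alt)
    case base
    show ?case
      by (intro exI[of _ "{}"] exI[of _ "\<lambda>_. 0"]) (simp add: lin)
  next
    case (step a x z)
    then obtain F v where F: "finite F" "\<And>r. A (v r) = r *\<^sub>R v r" "\<forall>r\<in>F. 0 \<le> r \<and> r \<le> N"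
      "\<And>r. r \<notin> F \<Longrightarrow> v r = 0" "z = (\<Sum>r\<in>F. v r)"
      by blast
    obtain s where s: "A x = s *\<^sub>R x" "0 \<le> s" "s \<le> N"
      using X[OF step.hyps(1)] by blast
    define w where "w r = (if r = s then a *\<^sub>C x else 0) + v r" for r
    have "(\<Sum>r\<in>insert s F. w r) = a *\<^sub>C x + (\<Sum>r\<in>insert s F. v r)"
      using F(1) by (simp add: w_def sum.distrib)
    also have "(\<Sum>r\<in>insert s F. v r) = z"
      unfolding F(5) using F(1,4) by (intro sum.mono_neutral_right) auto
    finally have "a *\<^sub>C x + z = (\<Sum>r\<in>insert s F. w r)" by simp
    moreover have "A (w r) = r *\<^sub>R w r" for r
      by (simp add: w_def lin F(2) s(1) scaleR_scaleC complex_vector.scale_right_distrib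
          complex_vector.scale_left_commute)
    ultimately show ?case
      using F s by (intro exI[of _ "insert s F"] exI[of _ w]) (auto simp: w_def)
  qed
  then obtain F v where F: "finite F" "\<And>r. A (v r) = r *\<^sub>R v r" "\<And>r. r \<in> F \<Longrightarrow> 0 \<le> r \<and> r \<le> N"
    "y = (\<Sum>r\<in>F. v r)"
    by blast
  have orth: "pairwise (\<lambda>r s. orthogonal (v r) (v s)) F"
    unfolding pairwise_def orthogonal_def inner_eq_Re_cinner
    using positive_op_eigenvectors_orthogonal[OF A F(2) F(2)] by simp
  have N: "0 \<le> N" if "F \<noteq> {}"
    using F(3) that by fastforce
  have Ay: "A y = (\<Sum>r\<in>F. r *\<^sub>R v r)"
    using bA F by (simp add: bounded_clinear_def linear_sum bounded_linear.linear)
  have "(norm (A y))\<^sup>2 = (\<Sum>r\<in>F. (norm (r *\<^sub>R v r))\<^sup>2)"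
    unfolding Ay using F(1) orth
    by (intro norm_sum_Pythagorean) (auto simp: pairwise_def orthogonal_clauses)
  also have "\<dots> \<le> (\<Sum>r\<in>F. N\<^sup>2 * (norm (v r))\<^sup>2)"
    using F(3) by (intro sum_mono) (auto simp: power_mult_distrib intro!: mult_right_mono power_mono)
  also have "\<dots> = (N * norm y)\<^sup>2"
    using norm_sum_Pythagorean[OF F(1) orth] F(4)
    by (simp add: sum_distrib_left power_mult_distrib)
  finally show ?thesis
    using N F(4) Ay by (cases "F = {}") (auto intro: power2_le_imp_le)
qed

text \<open>
  If \<open>x\<close> is a unit vector where the norm \<open>r\<close> on \<open>M\<close> is attained, then expanding
  \<open>(norm (A (A x) - r\<^sup>2 *\<^sub>R x))\<^sup>2\<close> and bounding \<open>norm (A (A x))\<close> by \<open>r\<^sup>2\<close> shows that it is zero.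
  So \<open>x\<close> is an eigenvector of \<open>A\<^sup>2\<close>, hence of \<open>A\<close>.
\<close>

lemma positive_op_norm_attaining_iff:
  assumes A: "positive_op A" and M: "complex_vector.subspace M" and inv: "A ` M \<subseteq> M" and "M \<noteq> {0}"
  shows "norm_attaining_on A M \<longleftrightarrow>
    (\<exists>x\<in>M. \<exists>r. x \<noteq> 0 \<and> A x = r *\<^sub>R x \<and> (\<forall>y\<in>M. norm (A y) \<le> r * norm y))"
    (is "_ \<longleftrightarrow> ?rhs")
proof -
  note bA = positive_op_bounded_clinear[OF A]
  note lin = bounded_clinear_simps[OF bA]
  note M' = subspace_complex_imp_real[OF M]
  let ?S = "(\<lambda>y. norm (A y)) ` {y \<in> M. norm y = 1}"
  show ?thesis
  proof
    assume "norm_attaining_on A M"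
    then obtain x where x: "x \<in> M" "norm x = 1" "norm (A x) = Sup ?S"
      unfolding norm_attaining_on_def by blast
    define r where "r = norm (A x)"
    obtain B where "\<And>x. norm (A x) \<le> B * norm x"
      using bounded_clinear_bound[OF bA] by blast
    then have "bdd_above ?S"
      by (intro bdd_aboveI[of _ B]) (auto, metis mult.right_neutral)
    then have unit: "norm (A y) \<le> r" if "y \<in> M" "norm y = 1" for y
      using that by (auto simp: r_def x(3) intro: cSup_upper)
    have le: "norm (A y) \<le> r * norm y" if "y \<in> M" for y
    proof (cases "y = 0")
      case False
      then show ?thesis
        using unit[of "(1 / norm y) *\<^sub>R y"] that M'
        by (simp add: lin subspace_scale pos_divide_le_eq)
    qed (simp add: lin)
    have "(norm (A (A x) - r\<^sup>2 *\<^sub>R x))\<^sup>2 = (norm (A (A x)))\<^sup>2 - 2 * r\<^sup>2 * inner (A (A x)) x + r\<^sup>2 * r\<^sup>2"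
      using x(2) unfolding power2_norm_eq_inner norm_eq_1
      by (simp add: inner_diff_left inner_diff_right inner_commute algebra_simps)
    also have "inner (A (A x)) x = r\<^sup>2"
      using positive_op_inner_selfadjoint[OF A, of "A x" x]
      by (simp add: r_def power2_norm_eq_inner)
    also have "(norm (A (A x)))\<^sup>2 \<le> (r * r)\<^sup>2"
      using le[of "A x"] inv x(1) by (intro power_mono) (auto simp: r_def)
    finally have "(norm (A (A x) - r\<^sup>2 *\<^sub>R x))\<^sup>2 \<le> 0"
      by (simp add: power2_eq_square)
    then have "A (A x) = complex_of_real (r\<^sup>2) *\<^sub>C x"
      by (simp add: scaleR_scaleC)
    moreover have "x \<noteq> 0"
      using x(2) by auto
    ultimately obtain n where n: "0 \<le> n" "complex_of_real (r\<^sup>2) = complex_of_real (n\<^sup>2)" "A x = n *\<^sub>R x"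
      using positive_op_square_eigenvector[OF A] by metis
    then have "n = r"
      by (simp add: r_def x(2))
    then show ?rhs
      using x(1) \<open>x \<noteq> 0\<close> n(3) le by blast
  next
    assume ?rhs
    then obtain x r where x: "x \<in> M" "x \<noteq> 0" "A x = r *\<^sub>R x" "\<And>y. y \<in> M \<Longrightarrow> norm (A y) \<le> r * norm y"
      by blast
    define u where "u = (1 / norm x) *\<^sub>R x"
    have u: "u \<in> M" "norm u = 1" "A u = r *\<^sub>R u"
      using x(1-3) M' by (simp_all add: u_def subspace_scale lin)
    then have "norm (A u) = r"
      using x(4)[of u] norm_ge_zero[of "A u"] by simp
    moreover have "Sup ?S = norm (A u)"
    proof (rule cSup_eq_maximum)
      show "norm (A u) \<in> ?S"
        using u by blast
      show "t \<le> norm (A u)" if "t \<in> ?S" for t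
        using that x(4) \<open>norm (A u) = r\<close> by fastforce
    qed
    ultimately show "norm_attaining_on A M"
      unfolding norm_attaining_on_def using u by metis
  qed
qed

lemma positive_op_orth_complement_invariant:
  assumes "positive_op A" "A ` X \<subseteq> X"
  shows "A ` orth_complement X \<subseteq> orth_complement X"
  using assms(2) by (auto simp: orth_complement_def positive_op_selfadjoint[OF assms(1)])

lemma reducing_orth_complement:
  assumes "positive_op A" "A ` X \<subseteq> X"
  shows "orth_complement X \<in> reducing_subspaces A"
  unfolding reducing_subspaces_def
  using positive_op_orth_complement_invariant[OF assms(1)] assms(2)
  by (simp add: closed_orth_complement subspace_orth_complement)

lemma all_nonempty_subset_image:
  "(\<forall>Z. Z \<subseteq> f ` X \<and> Z \<noteq> {} \<longrightarrow> P Z) \<longleftrightarrow> (\<forall>Y. Y \<subseteq> X \<and> Y \<noteq> {} \<longrightarrow> P (f ` Y))"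
proof (intro iffI allI impI; elim conjE)
  fix Z assume all: "\<forall>Y. Y \<subseteq> X \<and> Y \<noteq> {} \<longrightarrow> P (f ` Y)" and "Z \<subseteq> f ` X" "Z \<noteq> {}"
  then obtain Y where "Y \<subseteq> X" "Z = f ` Y"
    by (meson subset_imageE)
  then show "P Z"
    using all \<open>Z \<noteq> {}\<close> by blast
qed (simp add: image_mono)

lemma reverse_well_ordered_of_real:
  "reverse_well_ordered (complex_of_real ` X) \<longleftrightarrow>
    (\<forall>Y. Y \<subseteq> X \<and> Y \<noteq> {} \<longrightarrow> (\<exists>m\<in>Y. \<forall>a\<in>Y. a \<le> m))"
  unfolding reverse_well_ordered_def by (subst all_nonempty_subset_image) auto

lemma reverse_well_ordered_strict_mono_image:
  assumes "strict_mono_on X f"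
  shows "reverse_well_ordered (complex_of_real ` f ` X) \<longleftrightarrow>
    reverse_well_ordered (complex_of_real ` X)"
proof -
  have "f a \<le> f m \<longleftrightarrow> a \<le> m" if "a \<in> X" "m \<in> X" for a m
    using strict_mono_onD[OF assms that(1,2)] strict_mono_onD[OF assms that(2,1)]
    by (cases a m rule: linorder_cases) auto
  then have max: "(\<exists>m\<in>f ` Y. \<forall>a\<in>f ` Y. a \<le> m) \<longleftrightarrow> (\<exists>m\<in>Y. \<forall>a\<in>Y. a \<le> m)" if "Y \<subseteq> X" for Y
    using that by (simp add: subset_iff)
  have "(\<forall>Z. Z \<subseteq> f ` X \<and> Z \<noteq> {} \<longrightarrow> (\<exists>m\<in>Z. \<forall>a\<in>Z. a \<le> m)) \<longleftrightarrow>
      (\<forall>Y. Y \<subseteq> X \<and> Y \<noteq> {} \<longrightarrow> (\<exists>m\<in>f ` Y. \<forall>a\<in>f ` Y. a \<le> m))"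
    by (rule all_nonempty_subset_image)
  also have "\<dots> \<longleftrightarrow> (\<forall>Y. Y \<subseteq> X \<and> Y \<noteq> {} \<longrightarrow> (\<exists>m\<in>Y. \<forall>a\<in>Y. a \<le> m))"
    using max by simp
  finally show ?thesis
    by (simp only: reverse_well_ordered_of_real)
qed

section \<open>Spectral characterisation of the class beta for positive operators\<close>

lemma beta_top_eigenvector:
  assumes A: "positive_op A" and "A \<in> beta" and red: "M \<in> reducing_subspaces A" and ne: "M \<noteq> {0}"
  obtains x r where "x \<in> M" "x \<noteq> 0" "A x = r *\<^sub>R x" "\<And>y. y \<in> M \<Longrightarrow> norm (A y) \<le> r * norm y"
proof -
  have "norm_attaining_on A M"
    using assms by (simp add: beta_def)
  moreover have "complex_vector.subspace M" "A ` M \<subseteq> M"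
    using red by (simp_all add: reducing_subspaces_def)
  ultimately show thesis
    unfolding positive_op_norm_attaining_iff[OF A \<open>complex_vector.subspace M\<close> \<open>A ` M \<subseteq> M\<close> ne]
    using that by auto
qed

text \<open>
  The orthogonal complement of the eigenvectors is reducing. If it were non-zero, then \<open>A\<close> would
  have an eigenvector in it, orthogonal to itself.
\<close>

lemma beta_pure_point_spectrum:
  fixes A :: "'a::complex_hilbert_space \<Rightarrow> 'a"
  assumes A: "positive_op A" and beta: "A \<in> beta"
  shows "pure_point_spectrum A"
proof -
  have eigen_image: "A (A x) = r *\<^sub>R A x" if "A x = r *\<^sub>R x" for x r
    using bounded_clinear_scaleR[OF positive_op_bounded_clinear[OF A], of r x] that by simp
  \<comment> \<open>zero is included so that \<open>A\<close> maps the set into itself even on the kernel of \<open>A\<close>\<close>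
  define X where "X = {x. \<exists>r. A x = r *\<^sub>R x}"
  have red: "orth_complement X \<in> reducing_subspaces A"
    by (rule reducing_orth_complement[OF A]) (use eigen_image in \<open>auto simp: X_def\<close>)
  have "orth_complement X = {0}"
  proof (rule ccontr)
    assume ne: "orth_complement X \<noteq> {0}"
    obtain x r where "x \<in> orth_complement X" "x \<noteq> 0" "A x = r *\<^sub>R x"
      by (rule beta_top_eigenvector[OF A beta red ne])
    then show False
      using orth_complement_self[of x X] unfolding X_def by blast
  qed
  moreover have "orth_complement (eigenvectors A) = orth_complement X"
    by (auto simp: orth_complement_def X_def positive_op_eigenvectors_iff[OF A])
  ultimately show ?thesis
    by (simp add: pure_point_spectrum_def closure_span_eq_UNIV_iff)
qed

text \<open>
  Given a non-empty set \<open>Y\<close> of eigenvalues, let \<open>M\<close> be the closed span of the corresponding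
  eigenspaces. The top eigenvalue of \<open>A\<close> on \<open>M\<close> bounds all of \<open>Y\<close>, and it lies in \<open>Y\<close> since an
  eigenvector for any other eigenvalue is orthogonal to \<open>M\<close>.
\<close>

lemma beta_reverse_well_ordered:
  fixes A :: "'a::complex_hilbert_space \<Rightarrow> 'a"
  assumes A: "positive_op A" and beta: "A \<in> beta"
  shows "reverse_well_ordered (point_spectrum A)"
  unfolding positive_op_point_spectrum[OF A] reverse_well_ordered_of_real
proof (intro allI impI, elim conjE)
  fix Y assume Y: "Y \<subseteq> real_eigenvalues A" "Y \<noteq> {}"
  have eigen_image: "A (A x) = r *\<^sub>R A x" if "A x = r *\<^sub>R x" for x r
    using bounded_clinear_scaleR[OF positive_op_bounded_clinear[OF A], of r x] that by simp
  define X where "X = {x. \<exists>r\<in>Y. A x = r *\<^sub>R x}"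
  \<comment> \<open>the closed span of \<open>X\<close>, in a form that is visibly a reducing subspace\<close>
  define M where "M = orth_complement (orth_complement X)"
  have red: "M \<in> reducing_subspaces A"
    unfolding M_def
    by (intro reducing_orth_complement positive_op_orth_complement_invariant A)
      (use eigen_image in \<open>auto simp: X_def\<close>)
  have XM: "X \<subseteq> M"
    by (simp add: M_def orth_complement_double)
  have eig: "\<exists>e\<in>M. e \<noteq> 0 \<and> A e = r *\<^sub>R e" if "r \<in> Y" for r
    using that Y(1) XM unfolding X_def real_eigenvalues_def by blast
  then have ne: "M \<noteq> {0}"
    using Y(2) by blast
  obtain x m where x: "x \<in> M" "x \<noteq> 0" "A x = m *\<^sub>R x"
    and le: "\<And>y. y \<in> M \<Longrightarrow> norm (A y) \<le> m * norm y"
    using beta_top_eigenvector[OF A beta red ne] by metis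
  have "m \<in> Y"
  proof (rule ccontr)
    assume "m \<notin> Y"
    then have "x \<in> orth_complement X"
      using positive_op_eigenvectors_orthogonal[OF A x(3)]
      by (auto simp: X_def orth_complement_def)
    then show False
      using orth_complement_self x(1,2) unfolding M_def by blast
  qed
  moreover have "r \<le> m" if "r \<in> Y" for r
  proof -
    obtain e where "e \<in> M" "e \<noteq> 0" "A e = r *\<^sub>R e"
      using eig[OF \<open>r \<in> Y\<close>] by blast
    then have "\<bar>r\<bar> * norm e \<le> m * norm e"
      using le[of e] by simp
    then show ?thesis
      using \<open>e \<noteq> 0\<close> by simp
  qed
  ultimately show "\<exists>m\<in>Y. \<forall>a\<in>Y. a \<le> m"
    by blast
qed

text \<open>
  Split an eigenvector as \<open>e = p + q\<close> along \<open>M\<close> and its orthogonal complement. Since both are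
  invariant, \<open>p\<close> is zero or an eigenvector for the same eigenvalue. A vector \<open>h\<close> of \<open>M\<close> orthogonal
  to the eigenvectors in \<open>M\<close> is therefore orthogonal to every eigenvector, and vanishes.
\<close>

lemma reducing_subspace_eigenvectors_dense:
  fixes A :: "'a::complex_hilbert_space \<Rightarrow> 'a"
  assumes A: "bounded_clinear A" and pure: "pure_point_spectrum A"
    and red: "M \<in> reducing_subspaces A"
  shows "M \<subseteq> closure (complex_vector.span (eigenvectors A \<inter> M))"
proof
  note lin = bounded_clinear_simps[OF A]
  fix y assume "y \<in> M"
  define G where "G = closure (complex_vector.span (eigenvectors A \<inter> M))"
  have M: "closed M" "complex_vector.subspace M" "A ` M \<subseteq> M"
      "A ` orth_complement M \<subseteq> orth_complement M"
    using red by (simp_all add: reducing_subspaces_def)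
  have "G \<subseteq> M"
    unfolding G_def by (intro closure_minimal complex_vector.span_minimal M) simp
  obtain g h where gh: "y = g + h" "g \<in> G" "h \<in> orth_complement G"
    unfolding G_def
    using orthogonal_decomposition[OF closed_closure complex_subspace_closure[OF complex_vector.subspace_span]]
    by metis
  then have "h \<in> M"
    using \<open>y \<in> M\<close> \<open>G \<subseteq> M\<close> complex_vector.subspace_diff[OF M(2), of y g] by auto
  have "cinner h e = 0" if e: "e \<in> eigenvectors A" for e
  proof -
    obtain \<mu> where \<mu>: "A e = \<mu> *\<^sub>C e"
      using e by (auto simp: eigenvectors_def)
    obtain p q where pq: "e = p + q" "p \<in> M" "q \<in> orth_complement M"
      using orthogonal_decomposition[OF M(1,2)] by metis
    \<comment> \<open>this vector lies both in \<open>M\<close> and in its orthogonal complement\<close>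
    define d where "d = A p - \<mu> *\<^sub>C p"
    have "d \<in> M"
      unfolding d_def using pq(2) M(2,3)
      by (intro complex_vector.subspace_diff complex_vector.subspace_scale) auto
    moreover have "d = \<mu> *\<^sub>C q - A q"
      using \<mu> unfolding d_def pq(1) by (simp add: lin complex_vector.scale_right_distrib algebra_simps)
    then have "d \<in> orth_complement M"
      using pq(3) M(4) subspace_orth_complement
      by (auto intro!: complex_vector.subspace_diff complex_vector.subspace_scale)
    ultimately have "A p = \<mu> *\<^sub>C p"
      using orth_complement_self d_def by fastforce
    then have "p = 0 \<or> p \<in> eigenvectors A \<inter> M"
      using pq(2) by (auto simp: eigenvectors_def)
    then have "p \<in> G"
      unfolding G_def
      by (metis closure_subset complex_vector.span_base complex_vector.span_zero subsetD)
    then have "cinner h p = 0"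
      using gh(3) by (simp add: orth_complement_def)
    moreover have "cinner q h = 0"
      using pq(3) \<open>h \<in> M\<close> by (simp add: orth_complement_def)
    then have "cinner h q = 0"
      by (metis cinner_commute complex_cnj_zero)
    ultimately show ?thesis
      by (simp add: pq(1) cinner_add_right)
  qed
  then have "h \<in> orth_complement (eigenvectors A)"
    by (simp add: orth_complement_def)
  then have "h = 0"
    using pure by (simp add: pure_point_spectrum_def closure_span_eq_UNIV_iff)
  then show "y \<in> closure (complex_vector.span (eigenvectors A \<inter> M))"
    using gh by (simp add: G_def)
qed

text \<open>
  The eigenvalues occurring in a reducing subspace \<open>M\<close> have a greatest element \<open>m\<close>. It bounds \<open>A\<close> on
  the span of the eigenvectors in \<open>M\<close>, by density on all of \<open>M\<close>, and its eigenvectors attain the bound.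
\<close>

lemma pure_point_reverse_well_ordered_imp_beta:
  fixes A :: "'a::complex_hilbert_space \<Rightarrow> 'a"
  assumes A: "positive_op A" and pure: "pure_point_spectrum A"
    and rwo: "reverse_well_ordered (point_spectrum A)"
  shows "A \<in> beta"
proof -
  note bA = positive_op_bounded_clinear[OF A]
  have "norm_attaining_on A M" if red: "M \<in> reducing_subspaces A" and ne: "M \<noteq> {0}" for M
  proof -
    have M: "complex_vector.subspace M" "A ` M \<subseteq> M"
      using red by (simp_all add: reducing_subspaces_def)
    let ?E = "eigenvectors A \<inter> M"
    have dense: "M \<subseteq> closure (complex_vector.span ?E)"
      by (rule reducing_subspace_eigenvectors_dense[OF bA pure red])
    define Y where "Y = {r. \<exists>x\<in>M. x \<noteq> 0 \<and> A x = r *\<^sub>R x}"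
    have "Y \<noteq> {}"
    proof
      assume "Y = {}"
      then have "?E = {}"
        unfolding Y_def by (blast dest: positive_op_eigenvectors_iff[OF A, THEN iffD1])
      then have "M \<subseteq> {0}"
        using dense by simp
      then show False
        using ne complex_vector.subspace_0[OF M(1)] by blast
    qed
    moreover have YA: "Y \<subseteq> real_eigenvalues A"
      by (auto simp: Y_def real_eigenvalues_def)
    moreover have "\<forall>Z. Z \<subseteq> real_eigenvalues A \<and> Z \<noteq> {} \<longrightarrow> (\<exists>m\<in>Z. \<forall>r\<in>Z. r \<le> m)"
      using rwo unfolding positive_op_point_spectrum[OF A] reverse_well_ordered_of_real .
    ultimately have "\<exists>m\<in>Y. \<forall>r\<in>Y. r \<le> m"
      by simp
    then obtain m where m: "m \<in> Y" "\<And>r. r \<in> Y \<Longrightarrow> r \<le> m"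
      by metis
    have "\<exists>r. A x = r *\<^sub>R x \<and> 0 \<le> r \<and> r \<le> m" if "x \<in> ?E" for x
    proof -
      obtain r where "A x = r *\<^sub>R x" "r \<in> Y"
        using \<open>x \<in> ?E\<close> by (auto simp: Y_def positive_op_eigenvectors_iff[OF A])
      then show ?thesis
        using m(2) YA real_eigenvalues_nonneg[OF A] by blast
    qed
    then have span: "complex_vector.span ?E \<subseteq> {y. norm (A y) \<le> m * norm y}"
      using positive_op_norm_le_on_span[OF A] by blast
    have "continuous_on UNIV A"
      using bA by (simp add: bounded_clinear_def linear_continuous_on)
    then have "closed {y. norm (A y) \<le> m * norm y}"
      by (intro closed_Collect_le continuous_intros)
    then have "norm (A y) \<le> m * norm y" if "y \<in> M" for y
      using closure_minimal[OF span] dense that by blast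
    moreover obtain x where "x \<in> M" "x \<noteq> 0" "A x = m *\<^sub>R x"
      using m(1) by (auto simp: Y_def)
    ultimately show ?thesis
      unfolding positive_op_norm_attaining_iff[OF A M ne] by blast
  qed
  then show ?thesis
    by (simp add: beta_def bA)
qed

lemma positive_op_in_beta_iff:
  fixes A :: "'a::complex_hilbert_space \<Rightarrow> 'a"
  assumes "positive_op A"
  shows "A \<in> beta \<longleftrightarrow> pure_point_spectrum A \<and> reverse_well_ordered (point_spectrum A)"
  using beta_pure_point_spectrum beta_reverse_well_ordered
    pure_point_reverse_well_ordered_imp_beta assms by blast

section \<open>Shifted squares\<close>

lemma shifted_square_eigen_iff:
  assumes A: "positive_op A" and "x \<noteq> 0"
  shows "A (A x) - complex_of_real (c\<^sup>2) *\<^sub>C x = \<mu> *\<^sub>C x \<longleftrightarrow>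
    (\<exists>r. A x = r *\<^sub>R x \<and> \<mu> = complex_of_real (r\<^sup>2 - c\<^sup>2))"
proof
  assume "A (A x) - complex_of_real (c\<^sup>2) *\<^sub>C x = \<mu> *\<^sub>C x"
  then have "A (A x) = (\<mu> + complex_of_real (c\<^sup>2)) *\<^sub>C x"
    by (simp add: complex_vector.scale_left_distrib algebra_simps)
  then obtain n where "\<mu> + complex_of_real (c\<^sup>2) = complex_of_real (n\<^sup>2)" "A x = n *\<^sub>R x"
    using positive_op_square_eigenvector[OF A \<open>x \<noteq> 0\<close>] by metis
  then show "\<exists>r. A x = r *\<^sub>R x \<and> \<mu> = complex_of_real (r\<^sup>2 - c\<^sup>2)"
    by (intro exI[of _ n]) (simp add: algebra_simps)
next
  assume "\<exists>r. A x = r *\<^sub>R x \<and> \<mu> = complex_of_real (r\<^sup>2 - c\<^sup>2)"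
  then show "A (A x) - complex_of_real (c\<^sup>2) *\<^sub>C x = \<mu> *\<^sub>C x"
    by (auto simp: bounded_clinear_simps[OF positive_op_bounded_clinear[OF A]] scaleR_scaleC
        scaleC_scaleC power2_eq_square complex_vector.scale_left_diff_distrib)
qed

lemma shifted_square_spectral_conditions:
  fixes A :: "'a::complex_hilbert_space \<Rightarrow> 'a" and c :: real
  assumes A: "positive_op A"
  defines "L \<equiv> \<lambda>x. A (A x) - complex_of_real (c\<^sup>2) *\<^sub>C x"
  shows "pure_point_spectrum L \<longleftrightarrow> pure_point_spectrum A"
    and "reverse_well_ordered (point_spectrum L) \<longleftrightarrow> reverse_well_ordered (point_spectrum A)"
proof -
  note bA = positive_op_bounded_clinear[OF A]
  have "bounded_clinear (\<lambda>x. c\<^sup>2 *\<^sub>R x)"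
    by (rule bounded_clinear_scaleR_op[OF bounded_clinear_ident])
  then have bL: "bounded_clinear L"
    using bounded_clinear_diff_op[OF bounded_clinear_comp[OF bA bA]]
    by (simp add: L_def scaleR_scaleC)
  have eigen: "L x = \<mu> *\<^sub>C x \<longleftrightarrow> (\<exists>r. A x = r *\<^sub>R x \<and> \<mu> = complex_of_real (r\<^sup>2 - c\<^sup>2))"
    if "x \<noteq> 0" for x \<mu>
    unfolding L_def by (rule shifted_square_eigen_iff[OF A that])
  have "x \<in> eigenvectors L \<longleftrightarrow> x \<in> eigenvectors A" for x
    unfolding positive_op_eigenvectors_iff[OF A] unfolding eigenvectors_def
    using eigen[of x] by blast
  then have "eigenvectors L = eigenvectors A"
    by blast
  then show "pure_point_spectrum L \<longleftrightarrow> pure_point_spectrum A"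
    by (simp add: pure_point_spectrum_def)
  have "point_spectrum L = complex_of_real ` (\<lambda>r. r\<^sup>2 - c\<^sup>2) ` real_eigenvalues A"
  proof (rule set_eqI)
    fix \<mu>
    have "\<mu> \<in> point_spectrum L \<longleftrightarrow>
        (\<exists>x. x \<noteq> 0 \<and> (\<exists>r. A x = r *\<^sub>R x \<and> \<mu> = complex_of_real (r\<^sup>2 - c\<^sup>2)))"
      unfolding point_spectrum_iff[OF bL] using eigen[of _ \<mu>] by blast
    then show "\<mu> \<in> point_spectrum L \<longleftrightarrow>
        \<mu> \<in> complex_of_real ` (\<lambda>r. r\<^sup>2 - c\<^sup>2) ` real_eigenvalues A"
      by (auto simp: real_eigenvalues_def image_iff)
  qed
  moreover have "strict_mono_on (real_eigenvalues A) (\<lambda>r. r\<^sup>2 - c\<^sup>2)"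
    using real_eigenvalues_nonneg[OF A] by (intro strict_mono_onI) (simp add: power_strict_mono)
  ultimately show "reverse_well_ordered (point_spectrum L) \<longleftrightarrow>
      reverse_well_ordered (point_spectrum A)"
    using positive_op_point_spectrum[OF A] reverse_well_ordered_strict_mono_image by metis
qed

lemma cadjoint_add:
  fixes S T :: "'a::complex_hilbert_space \<Rightarrow> 'a"
  assumes "bounded_clinear S" "bounded_clinear T"
  shows "cadjoint (\<lambda>x. S x + T x) = (\<lambda>x. cadjoint S x + cadjoint T x)"
  by (intro cadjoint_unique bounded_clinear_add_op bounded_clinear_cadjoint assms)
    (simp add: cinner_add_left cinner_add_right cinner_cadjoint assms)

theorem theorem5p1:
  fixes T K D R L :: "'a::complex_hilbert_space \<Rightarrow> 'a" and c :: real
  assumes infinite_dim: "\<not> (\<exists>B::'a set. finite B \<and> complex_vector.span B = UNIV)"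
    and separable: "separable_space (euclidean :: 'a topology)"
    and T: "T \<in> beta0"
    and K: "compact_op K"
    and c: "c = Inf (Re ` point_spectrum (op_abs T))"
    and D: "D = (\<lambda>x. cadjoint T (T x) - complex_of_real (c\<^sup>2) *\<^sub>C x)"
    and R: "R = (\<lambda>x. cadjoint T (K x) + cadjoint K (T x) + cadjoint K (K x))"
    and L: "L = (\<lambda>x. D x + R x)"
  shows "(\<lambda>x. T x + K x) \<in> beta0 \<longleftrightarrow>
           pure_point_spectrum L \<and> reverse_well_ordered (point_spectrum L)"
proof -
  have bT: "bounded_clinear T" and bK: "bounded_clinear K"
    using T K by (simp_all add: beta0_def compact_op_def)
  define S where "S = (\<lambda>x. T x + K x)"
  have bS: "bounded_clinear S"
    unfolding S_def by (rule bounded_clinear_add_op[OF bT bK])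
  define A where "A = op_abs S"
  have A: "positive_op A"
    unfolding A_def by (rule positive_op_abs[OF bS])
  have "L = (\<lambda>x. A (A x) - complex_of_real (c\<^sup>2) *\<^sub>C x)"
    unfolding A_def op_abs_square[OF bS]
    unfolding S_def cadjoint_add[OF bT bK] L D R
    by (simp add: bounded_clinear_add[OF bounded_clinear_cadjoint] bT bK algebra_simps)
  then have "pure_point_spectrum L \<and> reverse_well_ordered (point_spectrum L) \<longleftrightarrow>
      pure_point_spectrum A \<and> reverse_well_ordered (point_spectrum A)"
    using shifted_square_spectral_conditions[OF A] by simp
  also have "\<dots> \<longleftrightarrow> A \<in> beta"
    by (rule positive_op_in_beta_iff[OF A, symmetric])
  also have "\<dots> \<longleftrightarrow> S \<in> beta0"
    by (simp add: beta0_def A_def bS)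
  finally show ?thesis
    by (simp add: S_def)
qed

end
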